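(* Let $\mathbb{E}\mathrm{la}$ be the space of 2D elasticity tensors and write $\mathbf{C}=(\lambda,\mu,\mathbf{h},\mathbf{H})$, with $\lambda,\mu\in\mathbb{H}^0(\mathbb{R}^2)$, $\mathbf{h}\in\mathbb{H}^2(\mathbb{R}^2)$, $\mathbf{H}\in\mathbb{H}^4(\mathbb{R}^2)$, in a fixed explicit harmonic decomposition $\mathbb{E}\mathrm{la}\simeq2\mathbb{H}^0\oplus\mathbb{H}^2\oplus\mathbb{H}^4$. Then: (1) a minimal integrity basis for $\mathrm{Cov}(\mathbb{E}\mathrm{la},\mathrm{SO}(2))$ consists of the $13$ covariants ($6$ invariants) $$\lambda,\ \mu,\ \mathbf{h}:\mathbf{h},\ \mathbf{H}::\mathbf{H},\ \mathbf{h}:\mathbf{H}:\mathbf{h},\ \mathbf{1},\ \mathbf{h},\ \mathbf{H}:\mathbf{h},\ \mathbf{H},\ \mathbf{h}:\mathbf{H}:(\mathbf{1}\times\mathbf{h}),\ \mathbf{1}\times\mathbf{h},\ \mathbf{H}:(\mathbf{1}\times\mathbf{h}),\ \mathbf{1}\times\mathbf{H};$$ (2) a minimal integrity basis for $\mathrm{Cov}(\mathbb{E}\mathrm{la},\mathrm{O}(2))$ consists of the $9$ covariants ($5$ invariants) $$\lambda,\ \mu,\ \mathbf{h}:\mathbf{h},\ \mathbf{H}::\mathbf{H},\ \mathbf{h}:\mathbf{H}:\mathbf{h},\ \mathbf{1},\ \mathbf{h},\ \mathbf{H}:\mathbf{h},\ \mathbf{H}.$$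
   Context: $\mathbb{E}\mathrm{la}$ is the space of fourth-order tensors on $\mathbb{R}^2$ with $C_{ijkl}=C_{jikl}=C_{ijlk}=C_{klij}$, with the standard tensorial action of $\mathrm{O}(2)$. $\mathbb{H}^0=\mathbb{R}$ is the trivial representation; for $n\ge1$, $\mathbb{H}^n(\mathbb{R}^2)$ is the space of totally symmetric traceless tensors of order $n$. An explicit harmonic decomposition is a choice of $\mathrm{O}(2)$-equivariant linear isomorphism with the indicated direct sum. $\mathrm{Inv}(\mathbb{V},G)$ is the algebra of $G$-invariant real polynomials on $\mathbb{V}$; $\mathrm{Cov}(\mathbb{V},G):=\mathrm{Inv}(\mathbb{V}\oplus\mathbb{R}^2,G)$ with standard action on $\mathbf{x}\in\mathbb{R}^2$. A tensor-valued covariant $\mathbf{c}$ of order $o$ (with totally symmetric values) is identified with the polynomial $\mathbf{c}(\mathbf{x},\dots,\mathbf{x})$; the order is the degree in $\mathbf{x}$; invariants are covariants of order $0$. An integrity basis is a finite set of homogeneous generators; it is minimal if no proper subset generates. $:$ and $::$ are contractions over two and four indices; $\mathbf{1}$ is the identity second-order tensor; $\mathbf{S}_1\times\mathbf{S}_2=-(\mathbf{S}_1\cdot\boldsymbol{\varepsilon}\cdot\mathbf{S}_2)^s$, with $\boldsymbol{\varepsilon}$ the Levi-Civita tensor ($\varepsilon_{12}=1$) and $(\cdot)^s$ total symmetrization. *)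

theory Defs
  imports "HOL-Analysis.Analysis"
begin

section \<open>Tensors on the plane\<close>

type_synonym vec2 = "real^2"
type_synonym tensor2 = "real^2^2"
type_synonym tensor4 = "real^2^2^2^2"

definition act2 :: "real^2^2 \<Rightarrow> tensor2 \<Rightarrow> tensor2" where
  "act2 g T = (\<chi> i j. \<Sum>p\<in>UNIV. \<Sum>q\<in>UNIV. g$i$p * g$j$q * T$p$q)"

definition act4 :: "real^2^2 \<Rightarrow> tensor4 \<Rightarrow> tensor4" where
  "act4 g T = (\<chi> i j k l. \<Sum>p\<in>UNIV. \<Sum>q\<in>UNIV. \<Sum>r\<in>UNIV. \<Sum>s\<in>UNIV.
     g$i$p * g$j$q * g$k$r * g$l$s * T$p$q$r$s)"

abbreviation O2 :: "(real^2^2) set" where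
  "O2 \<equiv> {g. orthogonal_matrix g}"

abbreviation SO2 :: "(real^2^2) set" where
  "SO2 \<equiv> {g. rotation_matrix g}"

definition Ela :: "tensor4 set" where
  "Ela = {C. \<forall>i j k l. C$i$j$k$l = C$j$i$k$l \<and> C$i$j$k$l = C$i$j$l$k \<and> C$i$j$k$l = C$k$l$i$j}"

definition Harm2 :: "tensor2 set" where
  "Harm2 = {T. (\<forall>i j. T$i$j = T$j$i) \<and> (\<Sum>i\<in>UNIV. T$i$i) = 0}"

text \<open>Total symmetry of order 4 is stated on the adjacent transpositions, which generate the
  symmetric group; by symmetry the vanishing of a single trace is the vanishing of all of them.\<close>

definition Harm4 :: "tensor4 set" where
  "Harm4 = {T. (\<forall>i j k l. T$i$j$k$l = T$j$i$k$l \<and> T$i$j$k$l = T$i$k$j$l \<and> T$i$j$k$l = T$i$j$l$k)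
             \<and> (\<forall>k l. (\<Sum>i\<in>UNIV. T$i$i$k$l) = 0)}"

definition sym2 :: "tensor2 \<Rightarrow> tensor2" where
  "sym2 T = (\<chi> i j. (T$i$j + T$j$i) / 2)"

definition sym4 :: "tensor4 \<Rightarrow> tensor4" where
  "sym4 T = (\<chi> i j k l. let a = (!) [i, j, k, l] in
     (\<Sum>\<sigma> | \<sigma> permutes {..<4}. T $ a (\<sigma> 0) $ a (\<sigma> 1) $ a (\<sigma> 2) $ a (\<sigma> 3)) / fact 4)"

text \<open>The names of the contractions record the orders of the two arguments: \<open>ddot\<close> is the
  contraction over two indices, \<open>qdot\<close> the one over four.\<close>

definition ddot22 :: "tensor2 \<Rightarrow> tensor2 \<Rightarrow> real" where
  "ddot22 a b = (\<Sum>i\<in>UNIV. \<Sum>j\<in>UNIV. a$i$j * b$i$j)"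

definition ddot42 :: "tensor4 \<Rightarrow> tensor2 \<Rightarrow> tensor2" where
  "ddot42 T a = (\<chi> i j. \<Sum>k\<in>UNIV. \<Sum>l\<in>UNIV. T$i$j$k$l * a$k$l)"

definition qdot44 :: "tensor4 \<Rightarrow> tensor4 \<Rightarrow> real" where
  "qdot44 S T = (\<Sum>i\<in>UNIV. \<Sum>j\<in>UNIV. \<Sum>k\<in>UNIV. \<Sum>l\<in>UNIV. S$i$j$k$l * T$i$j$k$l)"

definition dot24 :: "tensor2 \<Rightarrow> tensor4 \<Rightarrow> tensor4" where
  "dot24 a T = (\<chi> i j k l. \<Sum>p\<in>UNIV. a$i$p * T$p$j$k$l)"

abbreviation id_tensor :: tensor2 where
  "id_tensor \<equiv> mat 1"

definition levi_civita :: tensor2 where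
  "levi_civita = vector [vector [0, 1], vector [-1, 0]]"

text \<open>The product \<open>S\<^sub>1 \<times> S\<^sub>2 = -(S\<^sub>1 \<cdot> \<epsilon> \<cdot> S\<^sub>2)\<^sup>s\<close> of a second-order tensor with a tensor of order 2,
  respectively 4.  The single contraction of second-order tensors is the matrix product.\<close>

definition cross22 :: "tensor2 \<Rightarrow> tensor2 \<Rightarrow> tensor2" where
  "cross22 a b = - sym2 (a ** levi_civita ** b)"

definition cross24 :: "tensor2 \<Rightarrow> tensor4 \<Rightarrow> tensor4" where
  "cross24 a T = - sym4 (dot24 (a ** levi_civita) T)"


section \<open>Harmonic decompositions of the elasticity tensors\<close>

definition act_dec :: "real^2^2 \<Rightarrow> real \<times> real \<times> tensor2 \<times> tensor4 \<Rightarrow> real \<times> real \<times> tensor2 \<times> tensor4"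
  where "act_dec g = (\<lambda>(a, b, t, T). (a, b, act2 g t, act4 g T))"

text \<open>Linear \<open>O(2)\<close>-equivariant isomorphisms from \<open>Ela\<close> onto \<open>2H\<^sup>0 \<oplus> H\<^sup>2 \<oplus> H\<^sup>4\<close>; nothing is
  required of the values outside \<open>Ela\<close>.\<close>

definition harmonic_decomposition :: "(tensor4 \<Rightarrow> real \<times> real \<times> tensor2 \<times> tensor4) \<Rightarrow> bool" where
  "harmonic_decomposition \<Phi> \<longleftrightarrow>
     bij_betw \<Phi> Ela (UNIV \<times> UNIV \<times> Harm2 \<times> Harm4) \<and>
     (\<forall>C\<in>Ela. \<forall>D\<in>Ela. \<Phi> (C + D) = \<Phi> C + \<Phi> D) \<and>
     (\<forall>r. \<forall>C\<in>Ela. \<Phi> (r *\<^sub>R C) = r *\<^sub>R \<Phi> C) \<and>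
     (\<forall>g\<in>O2. \<forall>C\<in>Ela. \<Phi> (act4 g C) = act_dec g (\<Phi> C))"


section \<open>Invariants, covariants and integrity bases\<close>

text \<open>Polynomials on a linear subspace \<open>V\<close> are represented by polynomial functions that are
  \<open>undefined\<close> outside \<open>V\<close>, so that equality of such functions is equality on \<open>V\<close>.  Since linear forms
  on \<open>V\<close> extend to the ambient space, these are exactly the restrictions of the polynomial
  functions on the ambient space.\<close>

definition polynomials_on :: "'v::real_normed_vector set \<Rightarrow> ('v \<Rightarrow> real) set" where
  "polynomials_on V = {restrict p V | p. real_polynomial_function p}"

definition Inv :: "'v::real_normed_vector set \<Rightarrow> (real^2^2 \<Rightarrow> 'v \<Rightarrow> 'v) \<Rightarrow> (real^2^2) set \<Rightarrow> ('v \<Rightarrow> real) set"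
  where "Inv V \<rho> G = {p \<in> polynomials_on V. \<forall>g\<in>G. \<forall>v\<in>V. p (\<rho> g v) = p v}"

definition Cov :: "'v::real_normed_vector set \<Rightarrow> (real^2^2 \<Rightarrow> 'v \<Rightarrow> 'v) \<Rightarrow> (real^2^2) set
    \<Rightarrow> ('v \<times> vec2 \<Rightarrow> real) set"
  where "Cov V \<rho> G = Inv (V \<times> UNIV) (\<lambda>g (v, x). (\<rho> g v, g *v x)) G"

text \<open>The (unital) real algebra of functions on \<open>V\<close> generated by \<open>B\<close>.\<close>

inductive_set algebra_generated :: "'v set \<Rightarrow> ('v \<Rightarrow> real) set \<Rightarrow> ('v \<Rightarrow> real) set"
  for V :: "'v set" and B :: "('v \<Rightarrow> real) set" where
  gen: "p \<in> B \<Longrightarrow> p \<in> algebra_generated V B"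
| const: "(\<lambda>v\<in>V. c) \<in> algebra_generated V B"
| add: "p \<in> algebra_generated V B \<Longrightarrow> q \<in> algebra_generated V B
    \<Longrightarrow> (\<lambda>v\<in>V. p v + q v) \<in> algebra_generated V B"
| mult: "p \<in> algebra_generated V B \<Longrightarrow> q \<in> algebra_generated V B
    \<Longrightarrow> (\<lambda>v\<in>V. p v * q v) \<in> algebra_generated V B"

definition homogeneous_on :: "'v::real_vector set \<Rightarrow> ('v \<Rightarrow> real) \<Rightarrow> bool" where
  "homogeneous_on V p \<longleftrightarrow> (\<exists>d::nat. \<forall>v\<in>V. \<forall>t. p (t *\<^sub>R v) = t ^ d * p v)"

definition integrity_basis :: "'v::real_vector set \<Rightarrow> ('v \<Rightarrow> real) set \<Rightarrow> ('v \<Rightarrow> real) set \<Rightarrow> bool" where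
  "integrity_basis V A B \<longleftrightarrow>
     finite B \<and> B \<subseteq> A \<and> (\<forall>p\<in>B. homogeneous_on V p) \<and> algebra_generated V B = A"

definition minimal_integrity_basis :: "'v::real_vector set \<Rightarrow> ('v \<Rightarrow> real) set \<Rightarrow> ('v \<Rightarrow> real) set \<Rightarrow> bool"
  where "minimal_integrity_basis V A B \<longleftrightarrow>
     integrity_basis V A B \<and> (\<forall>B'. B' \<subset> B \<longrightarrow> algebra_generated V B' \<noteq> A)"

text \<open>Homogeneity of degree \<open>n\<close> in \<open>x\<close>; the invariants are the covariants of order \<open>0\<close>.\<close>

definition has_order :: "'v set \<Rightarrow> nat \<Rightarrow> ('v \<times> vec2 \<Rightarrow> real) \<Rightarrow> bool" where
  "has_order V n p \<longleftrightarrow> (\<forall>v\<in>V. \<forall>x t. p (v, t *\<^sub>R x) = t ^ n * p (v, x))"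

text \<open>The polynomial \<open>c(x, \<dots>, x)\<close> of a tensor-valued map \<open>c\<close> of order 0, 2 or 4 on \<open>Ela\<close>.\<close>

definition cov0 :: "(tensor4 \<Rightarrow> real) \<Rightarrow> tensor4 \<times> vec2 \<Rightarrow> real" where
  "cov0 c = (\<lambda>(C, x)\<in>Ela \<times> UNIV. c C)"

definition cov2 :: "(tensor4 \<Rightarrow> tensor2) \<Rightarrow> tensor4 \<times> vec2 \<Rightarrow> real" where
  "cov2 c = (\<lambda>(C, x)\<in>Ela \<times> UNIV. \<Sum>i\<in>UNIV. \<Sum>j\<in>UNIV. c C $i$j * x$i * x$j)"

definition cov4 :: "(tensor4 \<Rightarrow> tensor4) \<Rightarrow> tensor4 \<times> vec2 \<Rightarrow> real" where
  "cov4 c = (\<lambda>(C, x)\<in>Ela \<times> UNIV. \<Sum>i\<in>UNIV. \<Sum>j\<in>UNIV. \<Sum>k\<in>UNIV. \<Sum>l\<in>UNIV.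
     c C $i$j$k$l * x$i * x$j * x$k * x$l)"

end

theory Submission
  imports Defs
begin

text \<open>In the plane harmonic tensors are complex numbers.  With the null vector \<open>\<nu> = (1, -\<i>)\<close>, the tensors
of \<open>H\<^sup>2\<close> are the real parts \<open>Re (u \<nu>\<nu>)\<close>, those of \<open>H\<^sup>4\<close> are \<open>Re (w \<nu>\<nu>\<nu>\<nu>)\<close>, and \<open>x\<close> becomes
\<open>z = x\<^sub>1 + \<i> x\<^sub>2\<close>.  A harmonic decomposition therefore gives coordinates \<open>(\<lambda>, \<mu>, u, w, z)\<close> on the
space of pairs \<open>(C, x)\<close>, in which the rotation by the unit number \<open>e\<close> multiplies \<open>u\<close>, \<open>w\<close>, \<open>z\<close>
by \<open>e\<^sup>2\<close>, \<open>e\<^sup>4\<close>, \<open>e\<close>, and a reflection is, up to a rotation, complex conjugation.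

Generation for \<open>SO(2)\<close>.  A polynomial is a complex combination of monomials in \<open>\<lambda>\<close>, \<open>\<mu>\<close>, \<open>u\<close>, \<open>w\<close>,
\<open>z\<close> and the conjugates of \<open>u\<close>, \<open>w\<close>, \<open>z\<close>.  Averaging over the \<open>N\<close>-th roots of unity,
\<open>N\<close> large, keeps exactly the monomials of weight zero (\<open>average_mon\<close>), so an invariant polynomial is a combination of these.  Each of them
factors into \<open>\<lambda>\<close>, \<open>\<mu>\<close>, the squared moduli of \<open>u\<close>, \<open>w\<close>, \<open>z\<close>, the four products
\<open>u cnj z\<^sup>2\<close>, \<open>w cnj z\<^sup>4\<close>, \<open>w cnj u\<^sup>2\<close>, \<open>w cnj u cnj z\<^sup>2\<close>, and their conjugates (\<open>weight_zero_induct\<close>).  Up to nonzero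
factors the thirteen covariants are \<open>\<lambda>\<close>, \<open>\<mu>\<close>, the three squared moduli, and the real and imaginary
parts of the four products.

Generation for \<open>O(2)\<close>.  An invariant polynomial that is moreover fixed by conjugation is a real
combination of real parts of monomials of weight zero.  The product of the imaginary parts of any
two of the four products is a polynomial in the nine reflection-invariant generators
(\<open>Im_mult_Im_rel\<close>), and this suffices to expand those real parts (\<open>R_weight_zero\<close>).

Minimality.  For each generator there is a subalgebra that contains the other twelve but not the given one
(\<open>gens_separated\<close>).  For eleven of them it consists of the functions that take the same value at two
suitable points.  The real and imaginary parts of \<open>w cnj u cnj z\<^sup>2\<close> cannot be treated so, because the
values of the other generators determine them: there the subalgebra is defined by the vanishing of
some low-order coefficients along a two-parameter family of points.  The nine generators for \<open>O(2)\<close>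
are among the thirteen, so the same subalgebras show their minimality.\<close>

section \<open>Subalgebras and generated algebras\<close>

definition subalgebra_on :: "'v set \<Rightarrow> ('v \<Rightarrow> real) set \<Rightarrow> bool" where
  "subalgebra_on V K \<longleftrightarrow> (\<forall>c. (\<lambda>v\<in>V. c) \<in> K) \<and>
     (\<forall>p\<in>K. \<forall>q\<in>K. (\<lambda>v\<in>V. p v + q v) \<in> K \<and> (\<lambda>v\<in>V. p v * q v) \<in> K)"

lemma algebra_generated_least:
  assumes "subalgebra_on V K" "B \<subseteq> K"
  shows "algebra_generated V B \<subseteq> K"
proof
  fix p assume "p \<in> algebra_generated V B"
  then show "p \<in> K"
  proof induction
    case (gen p)
    then show ?case using assms by blast
  qed (use assms(1) in \<open>simp_all only: subalgebra_on_def\<close>)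
qed

lemma subalgebra_on_Inv:
  assumes "\<And>g v. g \<in> G \<Longrightarrow> v \<in> V \<Longrightarrow> \<rho> g v \<in> V"
  shows "subalgebra_on V (Inv V \<rho> G)"
proof -
  have "(\<lambda>v\<in>V. c) \<in> polynomials_on V" for c :: real
    by (auto simp: polynomials_on_def intro: real_polynomial_function.intros)
  moreover have "(\<lambda>v\<in>V. p v + q v) \<in> polynomials_on V \<and> (\<lambda>v\<in>V. p v * q v) \<in> polynomials_on V"
    if pq: "p \<in> polynomials_on V" "q \<in> polynomials_on V" for p q
  proof -
    from pq obtain p' q' where "real_polynomial_function p'" "p = restrict p' V"
      "real_polynomial_function q'" "q = restrict q' V" by (auto simp: polynomials_on_def)
    moreover from this have "(\<lambda>v\<in>V. p v + q v) = restrict (\<lambda>v. p' v + q' v) V"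
      "(\<lambda>v\<in>V. p v * q v) = restrict (\<lambda>v. p' v * q' v) V" by auto
    ultimately show ?thesis
      unfolding polynomials_on_def by (blast intro: real_polynomial_function.intros)
  qed
  ultimately show ?thesis using assms by (auto simp: subalgebra_on_def Inv_def)
qed

lemma separated_distinct:
  assumes "\<And>i. i < length bs \<Longrightarrow> \<exists>K. subalgebra_on V K \<and> bs ! i \<notin> K \<and>
              (\<forall>j<length bs. j \<noteq> i \<longrightarrow> bs ! j \<in> K)"
  shows "distinct bs"
  unfolding distinct_conv_nth using assms by metis

text \<open>To see that no generator can be dropped it suffices to enclose, for each of them, the remaining ones
in a subalgebra that avoids it.  Indexing by positions in a list lets the same hypothesis also
exclude repetitions, hence determine the cardinality of the set of generators.\<close>

lemma separated_minimal:
  assumes sep: "\<And>i. i < length bs \<Longrightarrow> \<exists>K. subalgebra_on V K \<and> bs ! i \<notin> K \<and>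
              (\<forall>j<length bs. j \<noteq> i \<longrightarrow> bs ! j \<in> K)"
    and basis: "integrity_basis V A (set bs)"
  shows "minimal_integrity_basis V A (set bs)"
  unfolding minimal_integrity_basis_def
proof (intro conjI allI impI basis)
  fix B' assume B': "B' \<subset> set bs"
  then obtain i where i: "i < length bs" "bs ! i \<notin> B'" by (metis in_set_conv_nth psubsetE subsetI)
  from sep[OF i(1)] obtain K where K: "subalgebra_on V K" "bs ! i \<notin> K"
    "\<And>j. j < length bs \<Longrightarrow> j \<noteq> i \<Longrightarrow> bs ! j \<in> K" by blast
  have "B' \<subseteq> K"
  proof
    fix b assume b: "b \<in> B'"
    then obtain j where "j < length bs" "b = bs ! j" using B' by (metis in_set_conv_nth psubsetD)
    with b i K(3) show "b \<in> K" by metis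
  qed
  then have "bs ! i \<notin> algebra_generated V B'" using algebra_generated_least K by blast
  moreover have "bs ! i \<in> A" using basis i by (auto simp: integrity_basis_def)
  ultimately show "algebra_generated V B' \<noteq> A" by blast
qed

section \<open>Harmonic tensors as real parts of powers of a null vector\<close>

text \<open>\<open>\<nu> = (1, -\<i>)\<close> satisfies \<open>\<nu> \<bullet> \<nu> = 0\<close>, so its tensor powers are symmetric and traceless, and it is an
eigenvector of every rotation.  Both facts together make the action on harmonic tensors diagonal.\<close>

definition null_vector :: "2 \<Rightarrow> complex" where
  "null_vector i = (if i = 1 then 1 else - \<i>)"

lemma null_vector_simps [simp]: "null_vector 1 = 1" "null_vector 2 = - \<i>"
  by (auto simp: null_vector_def)

definition harm2 :: "complex \<Rightarrow> tensor2" where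
  "harm2 u = (\<chi> i j. Re (u * null_vector i * null_vector j))"

definition harm4 :: "complex \<Rightarrow> tensor4" where
  "harm4 w = (\<chi> i j k l. Re (w * null_vector i * null_vector j * null_vector k * null_vector l))"

lemma harm2_in: "harm2 u \<in> Harm2"
  by (auto simp: Harm2_def harm2_def sum_2 forall_2)

lemma harm4_in: "harm4 w \<in> Harm4"
  by (simp add: Harm4_def harm4_def sum_2 forall_2)

lemma Harm2_eq:
  assumes "T \<in> Harm2" shows "T = harm2 (Complex (T$1$1) (T$1$2))"
proof -
  have "T$2$1 = T$1$2" "T$2$2 = - T$1$1" using assms by (auto simp: Harm2_def sum_2)
  then show ?thesis by (simp add: harm2_def vec_eq_iff forall_2)
qed

lemma Harm4_eq:
  assumes "T \<in> Harm4" shows "T = harm4 (Complex (T$1$1$1$1) (T$1$1$1$2))"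
proof -
  have swap: "T$i$j$k$l = T$j$i$k$l" "T$i$j$k$l = T$i$k$j$l" "T$i$j$k$l = T$i$j$l$k" for i j k l
    using assms by (simp_all add: Harm4_def)
  have trace: "T$2$2$k$l = - T$1$1$k$l" for k l
  proof -
    have "(\<Sum>i\<in>UNIV. T$i$i$k$l) = 0" using assms unfolding Harm4_def by blast
    then show ?thesis by (simp add: sum_2)
  qed
  have "T$1$1$2$1 = T$1$1$1$2" "T$1$2$1$1 = T$1$1$1$2" "T$2$1$1$1 = T$1$1$1$2"
    using swap by metis+
  moreover have "T$1$1$2$2 = - T$1$1$1$1" "T$1$2$1$2 = - T$1$1$1$1" "T$2$1$1$2 = - T$1$1$1$1"
    "T$1$2$2$1 = - T$1$1$1$1" "T$2$1$2$1 = - T$1$1$1$1"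
    using swap trace[of 1 1] by metis+
  moreover have "T$1$2$2$2 = - T$1$1$1$2" "T$2$1$2$2 = - T$1$1$1$2"
    using swap trace[of 1 2] by metis+
  ultimately show ?thesis by (simp add: harm4_def vec_eq_iff forall_2 trace)
qed

lemma harm2_components [simp]: "harm2 u $ 1 $ 1 = Re u" "harm2 u $ 1 $ 2 = Im u"
  by (auto simp: harm2_def)

lemma harm4_components [simp]: "harm4 w $ 1 $ 1 $ 1 $ 1 = Re w" "harm4 w $ 1 $ 1 $ 1 $ 2 = Im w"
  by (auto simp: harm4_def)

definition rotation :: "complex \<Rightarrow> real^2^2" where
  "rotation e = vector [vector [Re e, - Im e], vector [Im e, Re e]]"

definition reflection :: "complex \<Rightarrow> real^2^2" where
  "reflection e = vector [vector [Re e, Im e], vector [Im e, - Re e]]"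

lemma orthogonal_2_cases:
  assumes "orthogonal_matrix (g :: real^2^2)"
  obtains (rotation) e where "cmod e = 1" "g = rotation e" | (reflection) e where "cmod e = 1" "g = reflection e" "det g = -1"
proof -
  define a b c d where "a = g$1$1" "b = g$1$2" "c = g$2$1" "d = g$2$2"
  have g: "g = vector [vector [a, b], vector [c, d]]"
    by (simp add: vec_eq_iff forall_2 a_b_c_d_def)
  have "transpose g ** g = mat 1" using assms by (simp add: orthogonal_matrix)
  then have eqs: "a*a + c*c = 1" "b*b + d*d = 1"
    by (auto simp: vec_eq_iff forall_2 g matrix_matrix_mult_def transpose_def mat_def sum_2)
  have det: "det g = a * d - b * c" by (simp add: det_2 a_b_c_d_def)
  have mod: "cmod (Complex a c) = 1" using eqs by (simp add: cmod_def power2_eq_square)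
  from det_orthogonal_matrix[OF assms] show thesis
  proof
    assume "det g = 1"
    \<comment> \<open>The columns are unit vectors, so the left-hand side is \<open>2 - 2 det g\<close>.\<close>
    then have "(a - d)^2 + (b + c)^2 = 0" using eqs det by (simp add: power2_eq_square algebra_simps)
    then have "d = a" "b = - c" by (auto simp: sum_power2_eq_zero_iff)
    then have "g = rotation (Complex a c)" by (simp add: g rotation_def)
    with mod show thesis by (rule that(1))
  next
    assume *: "det g = -1"
    \<comment> \<open>Here it is \<open>2 + 2 det g\<close>.\<close>
    then have "(a + d)^2 + (b - c)^2 = 0" using eqs det by (simp add: power2_eq_square algebra_simps)
    then have "d = - a" "b = c" by (auto simp: sum_power2_eq_zero_iff)
    then have "g = reflection (Complex a c)" by (simp add: g reflection_def)
    with mod show thesis using * by (rule that(2))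
  qed
qed

lemma det_rotation: "cmod e = 1 \<Longrightarrow> det (rotation e) = 1"
  by (simp add: det_2 rotation_def cmod_def power2_eq_square)

lemma rotation_in_SO2: "cmod e = 1 \<Longrightarrow> rotation e \<in> SO2"
  by (simp add: rotation_matrix_def det_rotation orthogonal_matrix vec_eq_iff forall_2
      matrix_matrix_mult_def transpose_def mat_def sum_2)
     (simp add: rotation_def cmod_def power2_eq_square)

lemma reflection_in_O2: "cmod e = 1 \<Longrightarrow> reflection e \<in> O2"
  by (simp add: orthogonal_matrix vec_eq_iff forall_2
      matrix_matrix_mult_def transpose_def mat_def sum_2)
     (simp add: reflection_def cmod_def power2_eq_square)

lemma rotation_null_vector:
  "(\<Sum>p\<in>UNIV. of_real (rotation e $ i $ p) * null_vector p) = e * null_vector i"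
  using exhaust_2[of i] by (auto simp: rotation_def sum_2 complex_eq_iff)

lemma reflection_null_vector:
  "(\<Sum>p\<in>UNIV. of_real (reflection e $ i $ p) * null_vector p) = cnj (e * null_vector i)"
  using exhaust_2[of i] by (auto simp: reflection_def sum_2 complex_eq_iff)

lemma act2_harm2: "act2 g (harm2 u) $ i $ j =
   Re (u * (\<Sum>p\<in>UNIV. of_real (g $ i $ p) * null_vector p) * (\<Sum>p\<in>UNIV. of_real (g $ j $ p) * null_vector p))"
  by (simp add: act2_def harm2_def sum_2 algebra_simps)

lemma act4_harm4: "act4 g (harm4 w) $ i $ j $ k $ l =
   Re (w * (\<Sum>p\<in>UNIV. of_real (g $ i $ p) * null_vector p) * (\<Sum>p\<in>UNIV. of_real (g $ j $ p) * null_vector p)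
   * (\<Sum>p\<in>UNIV. of_real (g $ k $ p) * null_vector p) * (\<Sum>p\<in>UNIV. of_real (g $ l $ p) * null_vector p))"
  by (simp add: act4_def harm4_def sum_2 algebra_simps)

text \<open>The action replaces each factor \<open>\<nu>\<close> by \<open>g \<nu>\<close>, which for a rotation is \<open>e \<nu>\<close>.\<close>

lemma act_rotation: "act2 (rotation e) (harm2 u) = harm2 (e^2 * u)" "act4 (rotation e) (harm4 w) = harm4 (e^4 * w)"
  unfolding vec_eq_iff act2_harm2 act4_harm4 rotation_null_vector
  by (simp_all add: harm2_def harm4_def power2_eq_square power4_eq_xxxx mult_ac)

lemma Re_cnj_swap: "Re (u * cnj a) = Re (cnj u * a)"
  by simp

text \<open>A reflection maps \<open>\<nu>\<close> to the conjugate of \<open>e \<nu>\<close>, and \<open>Re (u cnj a) = Re (cnj u a)\<close> moves the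
conjugation to the coefficient.\<close>

lemma act_reflection: "act2 (reflection e) (harm2 u) = harm2 (e^2 * cnj u)"
  "act4 (reflection e) (harm4 w) = harm4 (e^4 * cnj w)"
proof -
  have "Re (u * cnj (e * null_vector i) * cnj (e * null_vector j)) =
     Re (e\<^sup>2 * cnj u * null_vector i * null_vector j)" for i j
    using Re_cnj_swap[of u "e * null_vector i * (e * null_vector j)"]
    by (simp only: complex_cnj_mult power2_eq_square mult_ac)
  then show "act2 (reflection e) (harm2 u) = harm2 (e^2 * cnj u)"
    unfolding vec_eq_iff act2_harm2 reflection_null_vector by (simp add: harm2_def del: complex_cnj_mult)
  have "Re (w * cnj (e * null_vector i) * cnj (e * null_vector j) * cnj (e * null_vector k) * cnj (e * null_vector l)) =
     Re (e ^ 4 * cnj w * null_vector i * null_vector j * null_vector k * null_vector l)" for i j k l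
    using Re_cnj_swap[of w "e * null_vector i * (e * null_vector j) * (e * null_vector k) * (e * null_vector l)"]
    by (simp only: complex_cnj_mult power4_eq_xxxx mult_ac)
  then show "act4 (reflection e) (harm4 w) = harm4 (e^4 * cnj w)"
    unfolding vec_eq_iff act4_harm4 reflection_null_vector by (simp add: harm4_def del: complex_cnj_mult)
qed

section \<open>The tensor contractions in complex coordinates\<close>

definition vec_cpx :: "vec2 \<Rightarrow> complex" where
  "vec_cpx x = Complex (x$1) (x$2)"

lemma vec_cpx_rotation: "vec_cpx (rotation e *v x) = e * vec_cpx x"
  by (simp add: vec_cpx_def rotation_def matrix_vector_mult_def sum_2 complex_eq_iff)

lemma vec_cpx_reflection: "vec_cpx (reflection e *v x) = e * cnj (vec_cpx x)"
  by (simp add: vec_cpx_def reflection_def matrix_vector_mult_def sum_2 complex_eq_iff)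

lemma ddot22_harm: "ddot22 (harm2 u) (harm2 v) = 2 * Re (u * cnj v)"
  by (simp add: ddot22_def harm2_def sum_2)

lemma ddot42_harm: "ddot42 (harm4 w) (harm2 u) = harm2 (2 * w * cnj u)"
  by (simp add: ddot42_def harm2_def harm4_def sum_2 vec_eq_iff forall_2)

lemma qdot44_harm: "qdot44 (harm4 v) (harm4 w) = 8 * Re (v * cnj w)"
  by (simp add: qdot44_def harm4_def sum_2)

text \<open>On harmonic tensors the product with the identity tensor is multiplication by \<open>\<i>\<close>: it turns real parts into
imaginary parts and so yields the second half of the \<open>SO(2)\<close> generators.\<close>

lemma cross22_harm: "cross22 id_tensor (harm2 u) = harm2 (\<i> * u)"
  by (simp add: cross22_def sym2_def levi_civita_def harm2_def sum_2 vec_eq_iff forall_2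
     matrix_matrix_mult_def mat_def)

text \<open>An entry of \<open>harm4 w\<close> is a product over its four index positions, which a permutation of the
positions leaves unchanged.\<close>

lemma sym4_harm: "sym4 (harm4 w) = harm4 w"
proof -
  have entry: "harm4 w $ a 0 $ a 1 $ a 2 $ a 3 = Re (w * (\<Prod>m<4. null_vector (a m)))" for a :: "nat \<Rightarrow> 2"
  proof -
    have "(\<Prod>m<4. null_vector (a m)) = null_vector (a 0) * null_vector (a 1) * null_vector (a 2) * null_vector (a 3)"
      by (simp add: eval_nat_numeral)
    then show ?thesis unfolding harm4_def by (simp only: vec_lambda_beta mult.assoc)
  qed
  have "harm4 w $ a (\<sigma> 0) $ a (\<sigma> 1) $ a (\<sigma> 2) $ a (\<sigma> 3) = harm4 w $ a 0 $ a 1 $ a 2 $ a 3"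
    if "\<sigma> permutes {..<4}" for a :: "nat \<Rightarrow> 2" and \<sigma>
  proof -
    have "prod (\<lambda>m. null_vector (a m)) {..<4} = prod ((\<lambda>m. null_vector (a m)) \<circ> \<sigma>) {..<4}"
      using that by (rule prod.permute)
    then show ?thesis using entry[of a] entry[of "a \<circ> \<sigma>"] by (simp only: o_def)
  qed
  note perm = this
  have "sym4 (harm4 w) $ i $ j $ k $ l = harm4 w $ i $ j $ k $ l" for i j k l
  proof -
    have "sym4 (harm4 w) $ i $ j $ k $ l =
      (\<Sum>\<sigma> | \<sigma> permutes {..<4::nat}. harm4 w $ ([i,j,k,l] ! 0) $ ([i,j,k,l] ! 1) $ ([i,j,k,l] ! 2) $ ([i,j,k,l] ! 3)) / fact 4"
      unfolding sym4_def Let_def vec_lambda_beta by (intro arg_cong2[where f = "(/)"] sum.cong refl) (rule perm, simp)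
    also have "card {\<sigma>. \<sigma> permutes {..<4::nat}} = fact 4"
      by (rule card_permutations) simp_all
    then have "(\<Sum>\<sigma> | \<sigma> permutes {..<4::nat}. harm4 w $ ([i,j,k,l] ! 0) $ ([i,j,k,l] ! 1) $ ([i,j,k,l] ! 2) $ ([i,j,k,l] ! 3)) / fact 4
      = harm4 w $ i $ j $ k $ l"
      by (simp add: eval_nat_numeral)
    finally show ?thesis .
  qed
  then show ?thesis by (simp add: vec_eq_iff)
qed

lemma cross24_harm: "cross24 id_tensor (harm4 w) = harm4 (\<i> * w)"
proof -
  have "dot24 (id_tensor ** levi_civita) (harm4 w) = harm4 (- \<i> * w)"
    by (simp add: dot24_def levi_civita_def harm4_def sum_2 vec_eq_iff forall_2)
  moreover have "- harm4 (- \<i> * w) = harm4 (\<i> * w)"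
    by (simp add: harm4_def vec_eq_iff)
  ultimately show ?thesis by (simp add: cross24_def sym4_harm)
qed

lemma harm2_form: "(\<Sum>i\<in>UNIV. \<Sum>j\<in>UNIV. harm2 u $ i $ j * x $ i * x $ j) = Re (u * cnj (vec_cpx x) ^ 2)"
  by (simp add: harm2_def sum_2 vec_cpx_def power2_eq_square algebra_simps)

lemma harm4_form: "(\<Sum>i\<in>UNIV. \<Sum>j\<in>UNIV. \<Sum>k\<in>UNIV. \<Sum>l\<in>UNIV. harm4 w $ i $ j $ k $ l * x $ i * x $ j * x $ k * x $ l)
   = Re (w * cnj (vec_cpx x) ^ 4)"
  by (simp add: harm4_def sum_2 vec_cpx_def power4_eq_xxxx algebra_simps)

lemma id_form: "(\<Sum>i\<in>UNIV. \<Sum>j\<in>UNIV. id_tensor $ i $ j * x $ i * x $ j) = cmod (vec_cpx x) ^ 2"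
  by (simp add: mat_def sum_2 vec_cpx_def cmod_def power2_eq_square algebra_simps)

section \<open>The space of elasticity tensors\<close>

lemma act4_Ela:
  assumes "C \<in> Ela" shows "act4 g C \<in> Ela"
proof -
  have swap: "C$i$j$k$l = C$j$i$k$l" "C$i$j$k$l = C$i$j$l$k" "C$i$j$k$l = C$k$l$i$j" for i j k l
    using assms by (simp_all add: Ela_def)
  have "C$1$1$2$1 = C$1$1$1$2" "C$1$2$1$1 = C$1$1$1$2" "C$2$1$1$1 = C$1$1$1$2"
    "C$2$2$1$1 = C$1$1$2$2" "C$2$1$1$2 = C$1$2$1$2" "C$1$2$2$1 = C$1$2$1$2" "C$2$1$2$1 = C$1$2$1$2"
    "C$2$2$1$2 = C$1$2$2$2" "C$2$2$2$1 = C$1$2$2$2" "C$2$1$2$2 = C$1$2$2$2"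
    using swap by metis+
  then show ?thesis
    by (simp add: Ela_def act4_def sum_2 forall_2 algebra_simps)
qed

lemma Ela_scale: "C \<in> Ela \<Longrightarrow> r *\<^sub>R C \<in> Ela" and Ela_add: "C \<in> Ela \<Longrightarrow> D \<in> Ela \<Longrightarrow> C + D \<in> Ela"
  by (simp_all add: Ela_def)

text \<open>Polynomials on \<open>Ela\<close> are restrictions of polynomials on the ambient space; composing with this
projection extends linear forms from \<open>Ela\<close>.\<close>

definition proj_Ela :: "tensor4 \<Rightarrow> tensor4" where
  "proj_Ela C = (\<chi> i j k l. (C$i$j$k$l + C$j$i$k$l + C$i$j$l$k + C$j$i$l$k
                           + C$k$l$i$j + C$l$k$i$j + C$k$l$j$i + C$l$k$j$i) / 8)"

lemma proj_Ela_in: "proj_Ela C \<in> Ela"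
  by (simp add: Ela_def proj_Ela_def)

lemma proj_Ela_id: "C \<in> Ela \<Longrightarrow> proj_Ela C = C"
  by (simp add: Ela_def proj_Ela_def vec_eq_iff)

lemma linear_proj_Ela: "linear proj_Ela"
  by (rule linearI) (simp_all add: proj_Ela_def vec_eq_iff field_simps)

section \<open>Rotation-invariant monomials\<close>

text \<open>The components are \<open>(\<lambda>, \<mu>, u, w, z)\<close>, where \<open>u\<close>, \<open>w\<close>, \<open>z\<close> have weights 2, 4, 1 under rotations.\<close>

type_synonym coords = "real \<times> real \<times> complex \<times> complex \<times> complex"

definition turn :: "complex \<Rightarrow> coords \<Rightarrow> coords" where
  "turn e = (\<lambda>(l, m, u, w, z). (l, m, e^2 * u, e^4 * w, e * z))"

definition mirror :: "coords \<Rightarrow> coords" where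
  "mirror = (\<lambda>(l, m, u, w, z). (l, m, cnj u, cnj w, cnj z))"

definition mon :: "nat \<Rightarrow> nat \<Rightarrow> nat \<Rightarrow> nat \<Rightarrow> nat \<Rightarrow> nat \<Rightarrow> nat \<Rightarrow> nat \<Rightarrow> coords \<Rightarrow> complex" where
  "mon i j a a' b b' c c' = (\<lambda>(l, m, u, w, z). of_real l ^ i * of_real m ^ j *
     (u ^ a * cnj u ^ a') * (w ^ b * cnj w ^ b') * (z ^ c * cnj z ^ c'))"

text \<open>The relative phases of \<open>u\<close>, \<open>w\<close> and \<open>z\<close>: the minimal monomials of weight zero that are not
real-valued, up to conjugation.\<close>

definition rel_ux :: "coords \<Rightarrow> complex" where "rel_ux = (\<lambda>(l, m, u, w, z). u * cnj z ^ 2)"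
definition rel_wx :: "coords \<Rightarrow> complex" where "rel_wx = (\<lambda>(l, m, u, w, z). w * cnj z ^ 4)"
definition rel_wu :: "coords \<Rightarrow> complex" where "rel_wu = (\<lambda>(l, m, u, w, z). w * cnj u ^ 2)"
definition rel_wux :: "coords \<Rightarrow> complex" where "rel_wux = (\<lambda>(l, m, u, w, z). w * cnj u * cnj z ^ 2)"

lemmas rel_defs = rel_ux_def rel_wx_def rel_wu_def rel_wux_def

definition modulus_invariants :: "(coords \<Rightarrow> complex) set" where
  "modulus_invariants = {\<lambda>(l, m, u, w, z). of_real l, \<lambda>(l, m, u, w, z). of_real m,
     \<lambda>(l, m, u, w, z). u * cnj u, \<lambda>(l, m, u, w, z). w * cnj w, \<lambda>(l, m, u, w, z). z * cnj z}"

definition phase_invariants :: "(coords \<Rightarrow> complex) set" where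
  "phase_invariants = {rel_ux, rel_wx, rel_wu, rel_wux}"

text \<open>A monomial divisible by no squared modulus contains each of \<open>u\<close>, \<open>w\<close>, \<open>z\<close> either unconjugated or
conjugated only.  Up to conjugation, if \<open>w\<close> occurs its weight 4 must be compensated by \<open>cnj u\<close> and \<open>cnj z\<close>, of
weights -2 and -1, in one of the combinations \<open>cnj u\<^sup>2\<close>, \<open>cnj u cnj z\<^sup>2\<close>, \<open>cnj z\<^sup>4\<close>; if not, \<open>u\<close> has to be compensated by
\<open>cnj z\<^sup>2\<close>.  So a factor always splits off.  The result is phrased as an induction rule,
because the property used for \<open>O(2)\<close> is preserved by these factors without being visibly closed
under products.\<close>

lemma weight_zero_induct [consumes 1, case_names one real complex cnj]:
  assumes weight: "2 * a + 4 * b + c = 2 * a' + 4 * b' + c'"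
    and one: "P (\<lambda>q. 1)"
    and real: "\<And>g f. g \<in> modulus_invariants \<Longrightarrow> P f \<Longrightarrow> P (\<lambda>q. g q * f q)"
    and complex: "\<And>g f. g \<in> phase_invariants \<Longrightarrow> P f \<Longrightarrow> P (\<lambda>q. g q * f q)"
    and cnj: "\<And>g f. g \<in> phase_invariants \<Longrightarrow> P f \<Longrightarrow> P (\<lambda>q. cnj (g q) * f q)"
  shows "P (mon i j a a' b b' c c')"
  using weight
proof (induction "i + j + a + a' + b + b' + c + c'" arbitrary: i j a a' b b' c c' rule: less_induct)
  case less
  note IH = less(1) and weight = less(2)
  have real_step: "P (mon i j a a' b b' c c')"
    if "g \<in> modulus_invariants" "mon i j a a' b b' c c' = (\<lambda>q. g q * mon i2 j2 a2 a2' b2 b2' c2 c2' q)"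
      "2 * a2 + 4 * b2 + c2 = 2 * a2' + 4 * b2' + c2'"
      "i2 + j2 + a2 + a2' + b2 + b2' + c2 + c2' < i + j + a + a' + b + b' + c + c'"
    for g i2 j2 a2 a2' b2 b2' c2 c2'
    unfolding that(2) by (rule real[OF that(1) IH[OF that(4,3)]])
  have complex_step: "P (mon i j a a' b b' c c')"
    if "g \<in> phase_invariants" "mon i j a a' b b' c c' = (\<lambda>q. g q * mon i2 j2 a2 a2' b2 b2' c2 c2' q)"
      "2 * a2 + 4 * b2 + c2 = 2 * a2' + 4 * b2' + c2'"
      "i2 + j2 + a2 + a2' + b2 + b2' + c2 + c2' < i + j + a + a' + b + b' + c + c'"
    for g i2 j2 a2 a2' b2 b2' c2 c2'
    unfolding that(2) by (rule complex[OF that(1) IH[OF that(4,3)]])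
  have cnj_step: "P (mon i j a a' b b' c c')"
    if "g \<in> phase_invariants" "mon i j a a' b b' c c' = (\<lambda>q. cnj (g q) * mon i2 j2 a2 a2' b2 b2' c2 c2' q)"
      "2 * a2 + 4 * b2 + c2 = 2 * a2' + 4 * b2' + c2'"
      "i2 + j2 + a2 + a2' + b2 + b2' + c2 + c2' < i + j + a + a' + b + b' + c + c'"
    for g i2 j2 a2 a2' b2 b2' c2 c2'
    unfolding that(2) by (rule cnj[OF that(1) IH[OF that(4,3)]])
  note simps = mon_def modulus_invariants_def phase_invariants_def rel_defs fun_eq_iff
    power2_eq_square power4_eq_xxxx power_add
  consider "i > 0" | "j > 0" | "a > 0" "a' > 0" | "b > 0" "b' > 0" | "c > 0" "c' > 0"
    | "a \<ge> 1" "c' \<ge> 2" | "a' \<ge> 1" "c \<ge> 2" | "b \<ge> 1" "c' \<ge> 4" | "b' \<ge> 1" "c \<ge> 4"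
    | "b \<ge> 1" "a' \<ge> 2" | "b' \<ge> 1" "a \<ge> 2" | "b \<ge> 1" "a' \<ge> 1" "c' \<ge> 2" | "b' \<ge> 1" "a \<ge> 1" "c \<ge> 2"
    | "i = 0" "j = 0" "a = 0" "a' = 0" "b = 0" "b' = 0" "c = 0" "c' = 0"
  proof (cases "i = 0 \<and> j = 0 \<and> (a = 0 \<or> a' = 0) \<and> (b = 0 \<or> b' = 0) \<and> (c = 0 \<or> c' = 0)")
    case False
    then show ?thesis using that(1-5) by blast
  next
    case True
    consider "b \<ge> 1" "b' = 0" | "b' \<ge> 1" "b = 0" | "b = 0" "b' = 0" using True by linarith
    then show ?thesis
    proof cases
      case 1
      then have "2 * a' + c' \<ge> 4" using weight by linarith
      then have "a' \<ge> 2 \<or> a' \<ge> 1 \<and> c' \<ge> 2 \<or> c' \<ge> 4" by linarith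
      then show ?thesis using that(8,10,12) 1 by blast
    next
      case 2
      then have "2 * a + c \<ge> 4" using weight by linarith
      then have "a \<ge> 2 \<or> a \<ge> 1 \<and> c \<ge> 2 \<or> c \<ge> 4" by linarith
      then show ?thesis using that(9,11,13) 2 by blast
    next
      case 3
      then have "a \<ge> 1 \<and> c' \<ge> 2 \<or> a' \<ge> 1 \<and> c \<ge> 2 \<or> a = 0 \<and> a' = 0 \<and> c = 0 \<and> c' = 0"
        using weight True by (cases a; cases a'; cases c; cases c'; simp; linarith?)
      then show ?thesis using that(6,7,14) 3 True by blast
    qed
  qed
  then show ?case
  proof cases
    case 1
    then obtain n where "i = n + 1" using less_iff_Suc_add by fastforce
    then show ?thesis using weight
      by (intro real_step[of "\<lambda>(l, m, u, w, z). of_real l" n j a a' b b' c c']) (auto simp: simps)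
  next
    case 2
    then obtain n where "j = n + 1" using less_iff_Suc_add by fastforce
    then show ?thesis using weight
      by (intro real_step[of "\<lambda>(l, m, u, w, z). of_real m" i n a a' b b' c c']) (auto simp: simps)
  next
    case 3
    then obtain n n' where "a = n + 1" "a' = n' + 1" by (metis Suc_eq_plus1 gr0_implies_Suc)
    then show ?thesis using weight
      by (intro real_step[of "\<lambda>(l, m, u, w, z). u * cnj u" i j n n' b b' c c']) (auto simp: simps)
  next
    case 4
    then obtain n n' where "b = n + 1" "b' = n' + 1" by (metis Suc_eq_plus1 gr0_implies_Suc)
    then show ?thesis using weight
      by (intro real_step[of "\<lambda>(l, m, u, w, z). w * cnj w" i j a a' n n' c c']) (auto simp: simps)
  next
    case 5
    then obtain n n' where "c = n + 1" "c' = n' + 1" by (metis Suc_eq_plus1 gr0_implies_Suc)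
    then show ?thesis using weight
      by (intro real_step[of "\<lambda>(l, m, u, w, z). z * cnj z" i j a a' b b' n n']) (auto simp: simps)
  next
    case 6
    then obtain n n' where "a = n + 1" "c' = n' + 2" by (metis le_iff_add add.commute)
    then show ?thesis using weight
      by (intro complex_step[of rel_ux i j n a' b b' c n']) (auto simp: simps)
  next
    case 7
    then obtain n n' where "a' = n + 1" "c = n' + 2" by (metis le_iff_add add.commute)
    then show ?thesis using weight
      by (intro cnj_step[of rel_ux i j a n b b' n' c']) (auto simp: simps)
  next
    case 8
    then obtain n n' where "b = n + 1" "c' = n' + 4" by (metis le_iff_add add.commute)
    then show ?thesis using weight
      by (intro complex_step[of rel_wx i j a a' n b' c n']) (auto simp: simps)
  next
    case 9
    then obtain n n' where "b' = n + 1" "c = n' + 4" by (metis le_iff_add add.commute)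
    then show ?thesis using weight
      by (intro cnj_step[of rel_wx i j a a' b n n' c']) (auto simp: simps)
  next
    case 10
    then obtain n n' where "b = n + 1" "a' = n' + 2" by (metis le_iff_add add.commute)
    then show ?thesis using weight
      by (intro complex_step[of rel_wu i j a n' n b' c c']) (auto simp: simps)
  next
    case 11
    then obtain n n' where "b' = n + 1" "a = n' + 2" by (metis le_iff_add add.commute)
    then show ?thesis using weight
      by (intro cnj_step[of rel_wu i j n' a' b n c c']) (auto simp: simps)
  next
    case 12
    then obtain n n' n'' where "b = n + 1" "a' = n' + 1" "c' = n'' + 2" by (metis le_iff_add add.commute)
    then show ?thesis using weight
      by (intro complex_step[of rel_wux i j a n' n b' c n'']) (auto simp: simps)
  next
    case 13
    then obtain n n' n'' where "b' = n + 1" "a = n' + 1" "c = n'' + 2" by (metis le_iff_add add.commute)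
    then show ?thesis using weight
      by (intro cnj_step[of rel_wux i j n' a' b n n'' c']) (auto simp: simps)
  next
    case 14
    then have "mon i j a a' b b' c c' = (\<lambda>q. 1)" by (auto simp: mon_def)
    then show ?thesis using one by simp
  qed
qed

section \<open>Averaging over rotations\<close>

text \<open>Complex combinations of monomials, as functions; the inductive form avoids a normal form of the
coefficients.\<close>

inductive poly_fun :: "(coords \<Rightarrow> complex) \<Rightarrow> bool" where
  mon: "poly_fun (\<lambda>q. k * mon i j a a' b b' c c' q)"
| add: "poly_fun f \<Longrightarrow> poly_fun g \<Longrightarrow> poly_fun (\<lambda>q. f q + g q)"

lemma mon_mult: "mon i j a a' b b' c c' q * mon i2 j2 a2 a2' b2 b2' c2 c2' q =
   mon (i + i2) (j + j2) (a + a2) (a' + a2') (b + b2) (b' + b2') (c + c2) (c' + c2') q"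
  by (simp add: mon_def power_add split: prod.splits)

lemma poly_fun_mult:
  assumes "poly_fun f" "poly_fun g" shows "poly_fun (\<lambda>q. f q * g q)"
  using assms(1)
proof induction
  case (mon k i j a a' b b' c c')
  show ?case using assms(2)
  proof induction
    case (mon k2 i2 j2 a2 a2' b2 b2' c2 c2')
    have "(\<lambda>q. k * mon i j a a' b b' c c' q * (k2 * mon i2 j2 a2 a2' b2 b2' c2 c2' q)) =
      (\<lambda>q. (k * k2) * mon (i + i2) (j + j2) (a + a2) (a' + a2') (b + b2) (b' + b2') (c + c2) (c' + c2') q)"
      by (simp add: mon_mult[symmetric] mult_ac)
    then show ?case by (simp only: poly_fun.mon)
  next
    case (add f g)
    then show ?case by (simp add: distrib_left poly_fun.add)
  qed
next
  case (add f g)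
  then show ?case by (simp add: distrib_right poly_fun.add)
qed

text \<open>A mean over finitely many rotations suffices here, since a polynomial involves finitely many weights.\<close>

definition average :: "nat \<Rightarrow> (coords \<Rightarrow> complex) \<Rightarrow> coords \<Rightarrow> complex" where
  "average N f q = (\<Sum>j<N. f (turn (cis (2 * pi * real j / real N)) q)) / of_nat N"

lemma mon_turn: "mon i j a a' b b' c c' (turn e q) =
   e ^ (2 * a + 4 * b + c) * cnj e ^ (2 * a' + 4 * b' + c') * mon i j a a' b b' c c' q"
  by (simp add: mon_def turn_def power_mult_distrib power_add power_mult split: prod.splits)

lemma sum_roots_of_unity:
  assumes "p \<noteq> p'" "p + p' < N"
  shows "(\<Sum>j<N. cis (2 * pi * real j / real N) ^ p * cnj (cis (2 * pi * real j / real N)) ^ p') = 0"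
proof -
  define x where "x = cis (2 * pi * (real p - real p') / real N)"
  have N: "N > 0" using assms by simp
  have "cis (2 * pi * real j / real N) ^ p * cnj (cis (2 * pi * real j / real N)) ^ p' = x ^ j" for j
  proof -
    have "cis (2 * pi * real j / real N) ^ p * cnj (cis (2 * pi * real j / real N)) ^ p' =
      cis (real p * (2 * pi * real j / real N) + real p' * - (2 * pi * real j / real N))"
      by (simp only: cis_cnj Complex.DeMoivre cis_mult)
    also have "real p * (2 * pi * real j / real N) + real p' * - (2 * pi * real j / real N) =
      real j * (2 * pi * (real p - real p') / real N)"
      by (simp add: diff_divide_distrib algebra_simps)
    finally show ?thesis by (simp only: x_def Complex.DeMoivre)
  qed
  then have "(\<Sum>j<N. cis (2 * pi * real j / real N) ^ p * cnj (cis (2 * pi * real j / real N)) ^ p') = (\<Sum>j<N. x ^ j)"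
    by simp
  also have "\<dots> = (if x = 1 then of_nat N else (1 - x ^ N) / (1 - x))" by (rule sum_gp_strict)
  also have "x ^ N = cis (2 * pi * of_int (int p - int p'))" using N by (simp add: x_def Complex.DeMoivre)
  then have "x ^ N = 1" by (simp only: cis_multiple_2pi Ints_of_int)
  also have "x \<noteq> 1"
  proof
    assume "x = 1"
    then have "cos (2 * pi * (real p - real p') / real N) = 1" by (simp add: x_def complex_eq_iff)
    then obtain k :: int where "2 * pi * (real p - real p') / real N = of_int k * 2 * pi"
      by (auto simp: cos_one_2pi_int)
    then have "(2 * pi) * (real p - real p') = (2 * pi) * (of_int k * real N)" using N by (simp add: field_simps)
    then have "real p - real p' = of_int k * real N" by (simp only: mult_cancel_left) simp
    then have "real_of_int (int p - int p') = of_int (k * int N)" by simp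
    then have k: "int p - int p' = k * int N" using of_int_eq_iff by blast
    have "\<bar>int p - int p'\<bar> < int N" using assms by simp
    then have "\<bar>k\<bar> * int N < 1 * int N" unfolding k by (simp add: abs_mult)
    then have "k = 0" using N by (simp only: mult_less_cancel_right) auto
    then show False using k assms(1) by simp
  qed
  ultimately show ?thesis by simp
qed

lemma average_mon:
  assumes "2 * a + 4 * b + c + (2 * a' + 4 * b' + c') < N"
  shows "average N (\<lambda>q. k * mon i j a a' b b' c c' q) =
    (\<lambda>q. if 2 * a + 4 * b + c = 2 * a' + 4 * b' + c' then k * mon i j a a' b b' c c' q else 0)"
proof
  fix q
  have "average N (\<lambda>q. k * mon i j a a' b b' c c' q) q =
    (\<Sum>n<N. cis (2 * pi * real n / real N) ^ (2 * a + 4 * b + c) *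
      cnj (cis (2 * pi * real n / real N)) ^ (2 * a' + 4 * b' + c')) * (k * mon i j a a' b b' c c' q) / of_nat N"
    unfolding average_def mon_turn sum_distrib_right by (simp only: mult_ac)
  also have "\<dots> = (if 2 * a + 4 * b + c = 2 * a' + 4 * b' + c' then k * mon i j a a' b b' c c' q else 0)"
  proof (cases "2 * a + 4 * b + c = 2 * a' + 4 * b' + c'")
    case True
    have "x ^ n * cnj x ^ n = 1" if "cmod x = 1" for x n
      using that by (simp add: power_mult_distrib[symmetric] complex_norm_square[symmetric])
    then have "cis t ^ n * cnj (cis t) ^ n = 1" for t n by (simp del: cis_cnj)
    then show ?thesis using True assms by (simp del: cis_cnj)
  next
    case False
    then show ?thesis using sum_roots_of_unity[OF False assms] by simp
  qed
  finally show "average N (\<lambda>q. k * mon i j a a' b b' c c' q) q = \<dots>" .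
qed

text \<open>\<open>N\<close> has to exceed the total weight of every monomial occurring in \<open>f\<close>, hence the bound \<open>N0\<close>.\<close>

lemma average_induct:
  assumes "poly_fun f"
    and zero: "Q (\<lambda>q. 0)"
    and mon: "\<And>k i j a a' b b' c c'. 2 * a + 4 * b + c = 2 * a' + 4 * b' + c' \<Longrightarrow>
               Q (\<lambda>q. k * mon i j a a' b b' c c' q)"
    and add: "\<And>f g. Q f \<Longrightarrow> Q g \<Longrightarrow> Q (\<lambda>q. f q + g q)"
  shows "\<exists>N0. \<forall>N>N0. Q (average N f)"
  using assms(1)
proof induction
  case (mon k i j a a' b b' c c')
  show ?case
  proof (intro exI allI impI)
    fix N assume N: "2 * a + 4 * b + c + (2 * a' + 4 * b' + c') < N"
    show "Q (average N (\<lambda>q. k * mon i j a a' b b' c c' q))"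
      unfolding average_mon[OF N]
      by (cases "2 * a + 4 * b + c = 2 * a' + 4 * b' + c'") (simp_all only: if_True if_False zero assms(3) simp_thms)
  qed
next
  case (add f g)
  then obtain N1 N2 where "\<forall>N>N1. Q (average N f)" "\<forall>N>N2. Q (average N g)" by blast
  moreover have "average N (\<lambda>q. f q + g q) = (\<lambda>q. average N f q + average N g q)" for N
    by (simp add: average_def fun_eq_iff sum.distrib add_divide_distrib)
  ultimately show ?case using assms(4) by (intro exI[of _ "max N1 N2"]) simp
qed

section \<open>Generators of the invariant algebras\<close>

text \<open>\<open>R\<close> stands for membership in the algebra under construction.  Keeping it abstract allows the
argument to take place in coordinates, while generation is asserted on the space of pairs \<open>(C, x)\<close>.\<close>

locale real_function_algebra =
  fixes R :: "('q \<Rightarrow> real) \<Rightarrow> bool"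
  assumes R_const: "R (\<lambda>q. k)"
    and R_add: "R f \<Longrightarrow> R g \<Longrightarrow> R (\<lambda>q. f q + g q)"
    and R_mult: "R f \<Longrightarrow> R g \<Longrightarrow> R (\<lambda>q. f q * g q)"
begin

lemma R_cmult: "R f \<Longrightarrow> R (\<lambda>q. k * f q)"
  by (intro R_mult R_const)

lemma R_uminus: "R f \<Longrightarrow> R (\<lambda>q. - f q)"
  using R_cmult[of f "-1"] by simp

lemma R_diff: "R f \<Longrightarrow> R g \<Longrightarrow> R (\<lambda>q. f q - g q)"
  using R_add[of f "\<lambda>q. - g q"] R_uminus[of g] by simp

lemma R_power: "R f \<Longrightarrow> R (\<lambda>q. f q ^ n)"
  by (induction n) (auto intro: R_const R_mult)

text \<open>\<open>Re (f g) = Re f Re g - Im f Im g\<close> and \<open>Re (f cnj g) = Re f Re g + Im f Im g\<close>: one of the two real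
parts being known is enough.\<close>

lemma Im_mult_Im:
  assumes "R (\<lambda>q. Re (f q))" "R (\<lambda>q. Re (g q))"
    and "R (\<lambda>q. Re (f q * g q)) \<or> R (\<lambda>q. Re (f q * cnj (g q)))"
  shows "R (\<lambda>q. Im (f q) * Im (g q))"
  using assms(3)
proof
  assume "R (\<lambda>q. Re (f q * g q))"
  then have "R (\<lambda>q. Re (f q) * Re (g q) - Re (f q * g q))" by (intro R_diff R_mult assms)
  then show ?thesis by simp
next
  assume "R (\<lambda>q. Re (f q * cnj (g q)))"
  then have "R (\<lambda>q. Re (f q * cnj (g q)) - Re (f q) * Re (g q))" by (intro R_diff R_mult assms)
  then show ?thesis by simp
qed

end

definition sq_u :: "coords \<Rightarrow> real" where "sq_u = (\<lambda>(l, m, u, w, z). cmod u ^ 2)"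
definition sq_w :: "coords \<Rightarrow> real" where "sq_w = (\<lambda>(l, m, u, w, z). cmod w ^ 2)"
definition sq_x :: "coords \<Rightarrow> real" where "sq_x = (\<lambda>(l, m, u, w, z). cmod z ^ 2)"

lemmas sq_defs = sq_u_def sq_w_def sq_x_def

text \<open>For any two phase invariants \<open>f\<close>, \<open>g\<close>, one of \<open>f g\<close> and \<open>f cnj g\<close> is divisible by a squared
modulus, with a cofactor that involves at most one phase invariant.\<close>

lemma relation_products:
  "rel_ux q * cnj (rel_ux q) = of_real (sq_u q * sq_x q ^ 2)"
  "rel_ux q * cnj (rel_wx q) = of_real (sq_x q ^ 2) * cnj (rel_wux q)"
  "rel_ux q * rel_wu q = of_real (sq_u q) * rel_wux q"
  "rel_ux q * rel_wux q = of_real (sq_u q) * rel_wx q"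
  "rel_wx q * cnj (rel_wx q) = of_real (sq_w q * sq_x q ^ 4)"
  "rel_wx q * cnj (rel_wu q) = of_real (sq_w q) * rel_ux q ^ 2"
  "rel_wx q * cnj (rel_wux q) = of_real (sq_w q * sq_x q ^ 2) * rel_ux q"
  "rel_wu q * cnj (rel_wu q) = of_real (sq_w q * sq_u q ^ 2)"
  "rel_wu q * cnj (rel_wux q) = of_real (sq_w q * sq_u q) * cnj (rel_ux q)"
  "rel_wux q * cnj (rel_wux q) = of_real (sq_w q * sq_u q * sq_x q ^ 2)"
proof -
  obtain l m u w z where q: "q = (l, m, u, w, z)" by (cases q)
  have sq: "of_real (sq_u q) = u * cnj u" "of_real (sq_w q) = w * cnj w" "of_real (sq_x q) = z * cnj z"
    by (simp_all only: sq_defs q prod.case complex_norm_square)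
  have rel: "rel_ux q = u * (cnj z * cnj z)" "rel_wx q = w * (cnj z * cnj z * cnj z * cnj z)"
    "rel_wu q = w * (cnj u * cnj u)" "rel_wux q = w * cnj u * (cnj z * cnj z)"
    by (simp_all only: rel_defs q prod.case power2_eq_square power4_eq_xxxx)
  show "rel_ux q * cnj (rel_ux q) = of_real (sq_u q * sq_x q ^ 2)"
    "rel_ux q * cnj (rel_wx q) = of_real (sq_x q ^ 2) * cnj (rel_wux q)"
    "rel_ux q * rel_wu q = of_real (sq_u q) * rel_wux q"
    "rel_ux q * rel_wux q = of_real (sq_u q) * rel_wx q"
    "rel_wx q * cnj (rel_wx q) = of_real (sq_w q * sq_x q ^ 4)"
    "rel_wx q * cnj (rel_wu q) = of_real (sq_w q) * rel_ux q ^ 2"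
    "rel_wx q * cnj (rel_wux q) = of_real (sq_w q * sq_x q ^ 2) * rel_ux q"
    "rel_wu q * cnj (rel_wu q) = of_real (sq_w q * sq_u q ^ 2)"
    "rel_wu q * cnj (rel_wux q) = of_real (sq_w q * sq_u q) * cnj (rel_ux q)"
    "rel_wux q * cnj (rel_wux q) = of_real (sq_w q * sq_u q * sq_x q ^ 2)"
    by (simp_all only: rel sq of_real_mult of_real_power power2_eq_square power4_eq_xxxx
        complex_cnj_mult complex_cnj_cnj mult_ac)
qed

locale O2_algebra = real_function_algebra R for R :: "(coords \<Rightarrow> real) \<Rightarrow> bool" +
  assumes R_Re: "g \<in> modulus_invariants \<union> phase_invariants \<Longrightarrow> R (\<lambda>q. Re (g q))"
begin

lemma R_sq: "R sq_u" "R sq_w" "R sq_x"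
  using R_Re[of "\<lambda>(l, m, u, w, z). u * cnj u"] R_Re[of "\<lambda>(l, m, u, w, z). w * cnj w"]
    R_Re[of "\<lambda>(l, m, u, w, z). z * cnj z"]
  by (simp_all add: modulus_invariants_def sq_defs case_prod_unfold cmod_power2 flip: power2_eq_square)

lemma R_rel: "R (\<lambda>q. Re (rel_ux q))" "R (\<lambda>q. Re (rel_wx q))" "R (\<lambda>q. Re (rel_wu q))" "R (\<lambda>q. Re (rel_wux q))"
  using R_Re by (auto simp: phase_invariants_def)

lemma Im_mult_Im_rel:
  assumes "f \<in> phase_invariants" "g \<in> phase_invariants"
  shows "R (\<lambda>q. Im (f q) * Im (g q))"
proof -
  have scale: "Re (of_real r * x) = r * Re x" for r x by simp
  have Re_square: "Re (x ^ 2) = 2 * Re x ^ 2 - Re (x * cnj x)" for x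
    by (simp add: power2_eq_square)
  note intros = R_const R_mult R_power R_diff R_rel R_sq
  note simps = relation_products scale Re_complex_of_real complex_cnj complex_cnj_cnj Re_square
  have "R (\<lambda>q. Im (rel_ux q) * Im (rel_ux q))" "R (\<lambda>q. Im (rel_ux q) * Im (rel_wx q))"
    "R (\<lambda>q. Im (rel_wx q) * Im (rel_wx q))" "R (\<lambda>q. Im (rel_wx q) * Im (rel_wu q))"
    "R (\<lambda>q. Im (rel_wx q) * Im (rel_wux q))" "R (\<lambda>q. Im (rel_wu q) * Im (rel_wu q))"
    "R (\<lambda>q. Im (rel_wu q) * Im (rel_wux q))" "R (\<lambda>q. Im (rel_wux q) * Im (rel_wux q))"
    by (rule Im_mult_Im[OF _ _ disjI2]; (simp only: simps cnj.sel)?; intro intros)+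
  moreover have "R (\<lambda>q. Im (rel_ux q) * Im (rel_wu q))" "R (\<lambda>q. Im (rel_ux q) * Im (rel_wux q))"
    by (rule Im_mult_Im[OF _ _ disjI1]; (simp only: simps)?; intro intros)+
  ultimately show ?thesis
    using assms by (auto simp: phase_invariants_def mult.commute)
qed

text \<open>The real part alone does not pass through products, since \<open>Re (g f)\<close> involves \<open>Im g Im f\<close>.  The
invariant of the induction adds that \<open>Im f\<close> becomes an element of the algebra when multiplied by the
imaginary part of any phase invariant; this is preserved because the products of two such imaginary
parts are in the algebra.\<close>

lemma R_weight_zero:
  assumes "2 * a + 4 * b + c = 2 * a' + 4 * b' + c'"
  shows "R (\<lambda>q. Re (mon i j a a' b b' c c' q))"
proof -
  have step: "R (\<lambda>q. Re (g q * f q)) \<and> (\<forall>k\<in>phase_invariants. R (\<lambda>q. Im (k q) * Im (g q * f q)))"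
    if "R (\<lambda>q. Re (g q))" "R (\<lambda>q. Im (g q) * Im (f q))"
      "\<And>k. k \<in> phase_invariants \<Longrightarrow> R (\<lambda>q. Im (k q) * Im (g q))"
      "R (\<lambda>q. Re (f q))" "\<And>k. k \<in> phase_invariants \<Longrightarrow> R (\<lambda>q. Im (k q) * Im (f q))" for f g
  proof (intro conjI ballI)
    have "R (\<lambda>q. Re (g q) * Re (f q) - Im (g q) * Im (f q))" by (intro R_diff R_mult that)
    then show "R (\<lambda>q. Re (g q * f q))" by simp
    fix k assume "k \<in> phase_invariants"
    then have "R (\<lambda>q. Re (g q) * (Im (k q) * Im (f q)) + (Im (k q) * Im (g q)) * Re (f q))"
      by (intro R_add R_mult[of _ "\<lambda>q. Im (k q) * Im (f q)"] R_mult[of "\<lambda>q. Im (k q) * Im (g q)"] that)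
    then show "R (\<lambda>q. Im (k q) * Im (g q * f q))" by (simp add: algebra_simps)
  qed
  have "R (\<lambda>q. Re (mon i j a a' b b' c c' q)) \<and>
    (\<forall>k\<in>phase_invariants. R (\<lambda>q. Im (k q) * Im (mon i j a a' b b' c c' q)))"
    using assms
  proof (induction rule: weight_zero_induct)
    case one
    show ?case by (simp add: R_const)
  next
    case (real g f)
    then have "Im (g q) = 0" for q by (cases q) (auto simp: modulus_invariants_def)
    with real show ?case by (intro step) (auto simp: R_Re R_const)
  next
    case (complex g f)
    then show ?case by (intro step) (auto simp: R_Re Im_mult_Im_rel)
  next
    case (cnj g f)
    then have "R (\<lambda>q. - (Im (g q) * Im (f q)))"
      "\<And>k. k \<in> phase_invariants \<Longrightarrow> R (\<lambda>q. - (Im (k q) * Im (g q)))"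
      by (auto intro: R_uminus Im_mult_Im_rel)
    with cnj show ?case by (intro step) (auto simp: R_Re)
  qed
  then show ?thesis ..
qed

end

lemma mon_mirror: "mon i j a a' b b' c c' (mirror q) = cnj (mon i j a a' b b' c c' q)"
  by (simp add: mon_def mirror_def split: prod.splits)

lemma average_invariant:
  assumes "\<And>e q. cmod e = 1 \<Longrightarrow> p (turn e q) = p q" "N > 0"
  shows "average N p = p"
  using assms by (simp add: average_def fun_eq_iff)

text \<open>Averaging over the reflection as well turns \<open>k m\<close>, \<open>m\<close> a monomial of weight zero, into
\<open>k (m + cnj m)\<close>, whose real part is \<open>2 Re k Re m\<close>: no imaginary part of a monomial is left.\<close>

lemma (in O2_algebra) R_O2_invariant:
  assumes poly: "poly_fun (\<lambda>q. of_real (p q))"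
    and inv: "\<And>e q. cmod e = 1 \<Longrightarrow> p (turn e q) = p q" "\<And>q. p (mirror q) = p q"
  shows "R p"
proof -
  have "\<exists>N0. \<forall>N>N0. R (\<lambda>q. Re (average N (\<lambda>q. of_real (p q)) q + average N (\<lambda>q. of_real (p q)) (mirror q)))"
    using poly
  proof (rule average_induct)
    fix k i j and a a' b b' c c' :: nat assume "2 * a + 4 * b + c = 2 * a' + 4 * b' + c'"
    then have "R (\<lambda>q. (2 * Re k) * Re (mon i j a a' b b' c c' q))"
      by (intro R_cmult R_weight_zero)
    then show "R (\<lambda>q. Re (k * mon i j a a' b b' c c' q + k * mon i j a a' b b' c c' (mirror q)))"
      by (simp add: mon_mirror algebra_simps)
  next
    fix f g :: "coords \<Rightarrow> complex"
    assume "R (\<lambda>q. Re (f q + f (mirror q)))" "R (\<lambda>q. Re (g q + g (mirror q)))"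
    from R_add[OF this] show "R (\<lambda>q. Re (f q + g q + (f (mirror q) + g (mirror q))))"
      by (simp add: algebra_simps)
  qed (simp add: R_const)
  then obtain N where
    "R (\<lambda>q. Re (average (Suc N) (\<lambda>q. of_real (p q)) q + average (Suc N) (\<lambda>q. of_real (p q)) (mirror q)))"
    by blast
  moreover have "average (Suc N) (\<lambda>q. of_real (p q)) = (\<lambda>q. of_real (p q))"
    by (rule average_invariant) (simp_all add: inv)
  ultimately have "R (\<lambda>q. 2 * p q)" by (simp add: inv)
  from R_cmult[OF this, of "1/2"] show ?thesis by simp
qed

locale SO2_algebra = O2_algebra +
  assumes R_Im: "g \<in> phase_invariants \<Longrightarrow> R (\<lambda>q. Im (g q))"
begin

lemma R_weight_zero_Im:
  assumes "2 * a + 4 * b + c = 2 * a' + 4 * b' + c'"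
  shows "R (\<lambda>q. Im (mon i j a a' b b' c c' q))"
proof -
  have step: "R (\<lambda>q. Re (g q * f q)) \<and> R (\<lambda>q. Im (g q * f q))"
    if "R (\<lambda>q. Re (g q))" "R (\<lambda>q. Im (g q))" "R (\<lambda>q. Re (f q)) \<and> R (\<lambda>q. Im (f q))" for f g
  proof -
    have "R (\<lambda>q. Re (g q) * Re (f q) - Im (g q) * Im (f q))" "R (\<lambda>q. Re (g q) * Im (f q) + Im (g q) * Re (f q))"
      by (intro R_diff R_add R_mult that conjunct1[OF that(3)] conjunct2[OF that(3)])+
    then show ?thesis by simp
  qed
  have "R (\<lambda>q. Re (mon i j a a' b b' c c' q)) \<and> R (\<lambda>q. Im (mon i j a a' b b' c c' q))"
    using assms
  proof (induction rule: weight_zero_induct)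
    case one
    show ?case by (simp add: R_const)
  next
    case (real g f)
    then have "Im (g q) = 0" for q by (cases q) (auto simp: modulus_invariants_def)
    with real show ?case by (intro step) (auto simp: R_Re R_const)
  next
    case (complex g f)
    then show ?case by (intro step) (auto simp: R_Re R_Im)
  next
    case (cnj g f)
    then show ?case by (intro step) (auto simp: R_Re R_Im R_uminus)
  qed
  then show ?thesis ..
qed

lemma R_SO2_invariant:
  assumes poly: "poly_fun (\<lambda>q. of_real (p q))"
    and inv: "\<And>e q. cmod e = 1 \<Longrightarrow> p (turn e q) = p q"
  shows "R p"
proof -
  have "\<exists>N0. \<forall>N>N0. R (\<lambda>q. Re (average N (\<lambda>q. of_real (p q)) q))"
    using poly
  proof (rule average_induct)
    fix k i j and a a' b b' c c' :: nat assume *: "2 * a + 4 * b + c = 2 * a' + 4 * b' + c'"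
    have "R (\<lambda>q. Re k * Re (mon i j a a' b b' c c' q) - Im k * Im (mon i j a a' b b' c c' q))"
      by (intro R_diff R_cmult R_weight_zero[OF *] R_weight_zero_Im[OF *])
    then show "R (\<lambda>q. Re (k * mon i j a a' b b' c c' q))" by simp
  qed (simp_all add: R_const R_add)
  then obtain N where "R (\<lambda>q. Re (average (Suc N) (\<lambda>q. of_real (p q)) q))"
    by blast
  moreover have "average (Suc N) (\<lambda>q. of_real (p q)) = (\<lambda>q. of_real (p q))"
    by (rule average_invariant) (simp_all add: inv)
  ultimately show ?thesis by simp
qed

end

section \<open>The generators in coordinates\<close>

text \<open>The thirteen covariants in coordinates, with the numerical factors that the contractions
produce; the first nine are those fixed by reflections.\<close>

definition gens :: "(coords \<Rightarrow> real) list" where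
  "gens = [\<lambda>(l, m, u, w, z). l, \<lambda>(l, m, u, w, z). m, \<lambda>q. 2 * sq_u q, \<lambda>q. 8 * sq_w q, \<lambda>q. 4 * Re (rel_wu q),
     sq_x, \<lambda>q. Re (rel_ux q), \<lambda>q. 2 * Re (rel_wux q), \<lambda>q. Re (rel_wx q),
     \<lambda>q. 4 * Im (rel_wu q), \<lambda>q. - Im (rel_ux q), \<lambda>q. 2 * Im (rel_wux q), \<lambda>q. - Im (rel_wx q)]"

lemma length_gens: "length gens = 13"
  by (simp add: gens_def)

lemma O2_algebra_from_gens:
  assumes "real_function_algebra R" and gens: "\<And>f. f \<in> set (take 9 gens) \<Longrightarrow> R f"
  shows "O2_algebra R"
proof -
  interpret real_function_algebra R by fact
  have R: "R (\<lambda>(l, m, u, w, z). l)" "R (\<lambda>(l, m, u, w, z). m)" "R (\<lambda>q. 2 * sq_u q)" "R (\<lambda>q. 8 * sq_w q)"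
    "R (\<lambda>q. 4 * Re (rel_wu q))" "R sq_x" "R (\<lambda>q. Re (rel_ux q))" "R (\<lambda>q. 2 * Re (rel_wux q))"
    "R (\<lambda>q. Re (rel_wx q))"
    using gens by (simp_all add: gens_def)
  have "R sq_u" "R sq_w" "R (\<lambda>q. Re (rel_wu q))" "R (\<lambda>q. Re (rel_wux q))"
    using R_cmult[OF R(3), of "1/2"] R_cmult[OF R(4), of "1/8"] R_cmult[OF R(5), of "1/4"] R_cmult[OF R(8), of "1/2"]
    by simp_all
  note R' = this R(1,2,6,7,9)
  show ?thesis
  proof
    fix g :: "coords \<Rightarrow> complex" assume "g \<in> modulus_invariants \<union> phase_invariants"
    then show "R (\<lambda>q. Re (g q))"
      using R' by (auto simp: modulus_invariants_def phase_invariants_def sq_defs case_prod_unfold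
          cmod_power2 simp flip: power2_eq_square)
  qed
qed

lemma SO2_algebra_from_gens:
  assumes "real_function_algebra R" and gens: "\<And>f. f \<in> set gens \<Longrightarrow> R f"
  shows "SO2_algebra R"
proof -
  interpret O2_algebra R
    using assms by (intro O2_algebra_from_gens) (auto dest: in_set_takeD)
  have R: "R (\<lambda>q. 4 * Im (rel_wu q))" "R (\<lambda>q. - Im (rel_ux q))" "R (\<lambda>q. 2 * Im (rel_wux q))" "R (\<lambda>q. - Im (rel_wx q))"
    using gens by (simp_all add: gens_def)
  show ?thesis
  proof
    fix g :: "coords \<Rightarrow> complex" assume "g \<in> phase_invariants"
    then show "R (\<lambda>q. Im (g q))"
      using R_cmult[OF R(1), of "1/4"] R_cmult[OF R(3), of "1/2"] R_uminus[OF R(2)] R_uminus[OF R(4)]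
      by (auto simp: phase_invariants_def)
  qed
qed

lemma gens_turn:
  assumes "cmod e = 1" "f \<in> set gens" shows "f (turn e q) = f q"
proof -
  have "e * cnj e = 1" using assms(1) by (simp add: complex_norm_square[symmetric])
  then have e: "e ^ n * cnj e ^ n = 1" for n by (simp add: power_mult_distrib[symmetric])
  obtain l m u w z where q: "q = (l, m, u, w, z)" by (cases q)
  have "rel_ux (turn e q) = (e^2 * cnj e^2) * rel_ux q" "rel_wx (turn e q) = (e^4 * cnj e^4) * rel_wx q"
    "rel_wu (turn e q) = (e^4 * cnj e^4) * rel_wu q" "rel_wux (turn e q) = (e^4 * cnj e^4) * rel_wux q"
    by (simp_all add: q rel_defs turn_def power2_eq_square power4_eq_xxxx del: times_complex.sel)
  then have rel: "rel_ux (turn e q) = rel_ux q" "rel_wx (turn e q) = rel_wx q"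
    "rel_wu (turn e q) = rel_wu q" "rel_wux (turn e q) = rel_wux q" by (simp_all only: e mult_1)
  have sq: "sq_u (turn e q) = sq_u q" "sq_w (turn e q) = sq_w q" "sq_x (turn e q) = sq_x q"
    using assms(1) by (simp_all add: q sq_defs turn_def norm_mult norm_power)
  show ?thesis
    using assms(2) by (auto simp: gens_def rel sq) (auto simp: q turn_def)
qed

lemma gens_mirror:
  assumes "f \<in> set (take 9 gens)" shows "f (mirror q) = f q"
proof -
  obtain l m u w z where q: "q = (l, m, u, w, z)" by (cases q)
  have rel: "rel_ux (mirror q) = cnj (rel_ux q)" "rel_wx (mirror q) = cnj (rel_wx q)"
    "rel_wu (mirror q) = cnj (rel_wu q)" "rel_wux (mirror q) = cnj (rel_wux q)"
    by (simp_all add: q rel_defs mirror_def)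
  have sq: "sq_u (mirror q) = sq_u q" "sq_w (mirror q) = sq_w q" "sq_x (mirror q) = sq_x q"
    by (simp_all add: q sq_defs mirror_def)
  show ?thesis
    using assms by (auto simp: gens_def rel sq) (auto simp: q mirror_def)
qed

definition dilate :: "real \<Rightarrow> coords \<Rightarrow> coords" where
  "dilate t = (\<lambda>(l, m, u, w, z). (t * l, t * m, of_real t * u, of_real t * w, of_real t * z))"

text \<open>The degree is the total one, in \<open>C\<close> and \<open>x\<close> together.\<close>

lemma gens_homogeneous:
  assumes "f \<in> set gens" shows "\<exists>d. \<forall>q t. f (dilate t q) = t ^ d * f q"
proof -
  have rel: "rel_ux (dilate t q) = of_real (t ^ 3) * rel_ux q" "rel_wx (dilate t q) = of_real (t ^ 5) * rel_wx q"
    "rel_wu (dilate t q) = of_real (t ^ 3) * rel_wu q" "rel_wux (dilate t q) = of_real (t ^ 4) * rel_wux q" for t q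
    by (simp_all add: rel_defs dilate_def split_beta eval_nat_numeral del: times_complex.sel)
  have sq: "sq_u (dilate t q) = t ^ 2 * sq_u q" "sq_w (dilate t q) = t ^ 2 * sq_w q"
    "sq_x (dilate t q) = t ^ 2 * sq_x q" for t q
    by (simp_all add: sq_defs dilate_def split_beta norm_mult power_mult_distrib)
  have Re: "Re (of_real (t ^ n) * x) = t ^ n * Re x" and Im: "Im (of_real (t ^ n) * x) = t ^ n * Im x"
    for t n x by (simp_all del: of_real_power)
  let ?hom = "\<lambda>d f. \<forall>q t. f (dilate t q) = t ^ d * f q"
  have 1: "?hom 1 (\<lambda>(l, m, u, w, z). l)" "?hom 1 (\<lambda>(l, m, u, w, z). m)" by (simp_all add: dilate_def split_beta)
  have 2: "?hom 2 (\<lambda>q. 2 * sq_u q)" "?hom 2 (\<lambda>q. 8 * sq_w q)" "?hom 2 sq_x"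
    by (simp_all add: sq)
  have 3: "?hom 3 (\<lambda>q. 4 * Re (rel_wu q))" "?hom 3 (\<lambda>q. Re (rel_ux q))" "?hom 4 (\<lambda>q. 2 * Re (rel_wux q))"
    "?hom 5 (\<lambda>q. Re (rel_wx q))" "?hom 3 (\<lambda>q. 4 * Im (rel_wu q))" "?hom 3 (\<lambda>q. - Im (rel_ux q))"
    "?hom 4 (\<lambda>q. 2 * Im (rel_wux q))" "?hom 5 (\<lambda>q. - Im (rel_wx q))"
    by (simp_all only: rel Re Im, simp_all)
  have "list_all (\<lambda>f. \<exists>d. ?hom d f) gens"
    unfolding gens_def list.pred_inject(2) by (intro conjI list.pred_inject(1); rule exI; rule 1 2 3)
  then show ?thesis using assms by (simp add: list_all_iff)
qed

section \<open>Every generator is indispensable\<close>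

lemma subalgebra_two_points: "subalgebra_on UNIV {f. f P = f Q}"
  by (simp add: subalgebra_on_def)

text \<open>Along \<open>u = z = t\<close>, \<open>w = r \<omega>\<close> the product \<open>w cnj u cnj z\<^sup>2\<close> becomes \<open>\<omega> r t\<^sup>3\<close>, whereas the other
generators become multiples of \<open>t\<^sup>2\<close>, \<open>t\<^sup>3\<close>, \<open>r\<^sup>2\<close>, \<open>r t\<^sup>2\<close> and \<open>r t\<^sup>4\<close>.  Taking \<open>\<omega> = 1\<close> makes all imaginary parts
vanish and so isolates the real part; \<open>\<omega> = \<i>\<close> isolates the imaginary part.\<close>

definition jet_path :: "complex \<Rightarrow> real \<Rightarrow> real \<Rightarrow> coords" where
  "jet_path \<omega> r t = (0, 0, of_real t, of_real r * \<omega>, of_real t)"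

text \<open>The conditions say that the expansion along the path has no terms \<open>t\<close>, \<open>r\<close>, \<open>r t\<close>, \<open>r t\<^sup>3\<close>.  They
define a subalgebra: in a product, \<open>r t\<^sup>3\<close> can only arise from
\<open>1 \<cdot> r t\<^sup>3\<close>, \<open>t \<cdot> r t\<^sup>2\<close>, \<open>t\<^sup>2 \<cdot> r t\<close> or \<open>t\<^sup>3 \<cdot> r\<close>, each of which has an excluded factor, and likewise for the other
three terms.  The polynomial \<open>F\<close> is a polynomial in \<open>r\<close> with coefficients in \<open>t\<close>.\<close>

definition jet_algebra :: "complex \<Rightarrow> (coords \<Rightarrow> real) set" where
  "jet_algebra \<omega> = {f. \<exists>F :: real poly poly. (\<forall>r t. f (jet_path \<omega> r t) = poly (poly F [:r:]) t) \<and>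
     coeff (coeff F 0) 1 = 0 \<and> coeff (coeff F 1) 0 = 0 \<and> coeff (coeff F 1) 1 = 0 \<and> coeff (coeff F 1) 3 = 0}"

lemma jet_algebraI:
  assumes "\<And>r t. f (jet_path \<omega> r t) = poly (poly F [:r:]) t"
    and "coeff (coeff F 0) 1 = 0" "coeff (coeff F 1) 0 = 0" "coeff (coeff F 1) 1 = 0" "coeff (coeff F 1) 3 = 0"
  shows "f \<in> jet_algebra \<omega>"
  using assms unfolding jet_algebra_def by blast

lemma subalgebra_jet: "subalgebra_on UNIV (jet_algebra \<omega>)"
proof -
  have "(\<lambda>q. c) \<in> jet_algebra \<omega>" for c
    by (rule jet_algebraI[of _ _ "[:[:c:]:]"]) simp_all
  moreover have "(\<lambda>q. f q + g q) \<in> jet_algebra \<omega> \<and> (\<lambda>q. f q * g q) \<in> jet_algebra \<omega>"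
    if fg: "f \<in> jet_algebra \<omega>" "g \<in> jet_algebra \<omega>" for f g
  proof -
    from fg(1) obtain F where F: "\<And>r t. f (jet_path \<omega> r t) = poly (poly F [:r:]) t"
      "coeff (coeff F 0) 1 = 0" "coeff (coeff F 1) 0 = 0" "coeff (coeff F 1) 1 = 0" "coeff (coeff F 1) 3 = 0"
      unfolding jet_algebra_def by blast
    from fg(2) obtain G where G: "\<And>r t. g (jet_path \<omega> r t) = poly (poly G [:r:]) t"
      "coeff (coeff G 0) 1 = 0" "coeff (coeff G 1) 0 = 0" "coeff (coeff G 1) 1 = 0" "coeff (coeff G 1) 3 = 0"
      unfolding jet_algebra_def by blast
    have "(\<lambda>q. f q + g q) \<in> jet_algebra \<omega>"
      by (rule jet_algebraI[of _ _ "F + G"]) (use F G in simp_all)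
    moreover have "(\<lambda>q. f q * g q) \<in> jet_algebra \<omega>"
      by (rule jet_algebraI[of _ _ "F * G"])
         (use F G in \<open>simp_all add: coeff_mult numeral_3_eq_3 numeral_2_eq_2\<close>)
    ultimately show ?thesis ..
  qed
  ultimately show ?thesis unfolding subalgebra_on_def restrict_UNIV by blast
qed

lemma in_jet_algebra:
  assumes "\<And>r t. f (jet_path \<omega> r t) = a * t ^ 2 + b * t ^ 3 + c * r * t ^ 2 + d * r * t ^ 4 + e * r ^ 2"
  shows "f \<in> jet_algebra \<omega>"
  by (rule jet_algebraI[of _ _ "[:monom a 2 + monom b 3, monom c 2 + monom d 4, [:e:]:]"])
     (simp_all add: assms poly_monom power2_eq_square algebra_simps)

lemma not_in_jet_algebra:
  assumes f: "\<And>r t. f (jet_path \<omega> r t) = c * r * t ^ 3" and "c \<noteq> 0"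
  shows "f \<notin> jet_algebra \<omega>"
proof
  assume "f \<in> jet_algebra \<omega>"
  then obtain F where F: "\<And>r t. f (jet_path \<omega> r t) = poly (poly F [:r:]) t" and *: "coeff (coeff F 1) 3 = 0"
    unfolding jet_algebra_def by blast
  define D where "D = F - [:0, monom c 3:]"
  have "poly (poly D [:r:]) t = 0" for r t
    using trans[OF sym[OF f] F, of r t] by (simp add: D_def poly_monom mult_ac)
  then have "poly D [:r:] = 0" for r
    by (metis poly_all_0_iff_0)
  \<comment> \<open>Every constant polynomial is a root of \<open>D\<close>, so \<open>D\<close> has infinitely many roots.\<close>
  then have "range (\<lambda>r::real. [:r:]) \<subseteq> {x. poly D x = 0}" by auto
  moreover have "infinite (range (\<lambda>r::real. [:r:]))"
    using finite_imageD[of "\<lambda>r::real. [:r:]" UNIV] by (auto simp: inj_def infinite_UNIV_char_0)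
  ultimately have "D = 0" using poly_roots_finite[of D] finite_subset by blast
  then have "F = [:0, monom c 3:]" by (simp add: D_def)
  with * \<open>c \<noteq> 0\<close> show False by simp
qed

text \<open>The pairs of points keep at zero whatever would make another generator see the difference, and
rotate a single phase by a half-turn: the real or imaginary part in question changes sign while the
squared moduli and the other part stay fixed.  For \<open>\<lambda>\<close>, \<open>\<mu>\<close> and the squared moduli the origin serves as second
point; for the two parts of \<open>w cnj u cnj z\<^sup>2\<close> the jet algebras replace the points.\<close>

lemma gens_separated:
  assumes "i < length gens"
  shows "\<exists>K. subalgebra_on UNIV K \<and> gens ! i \<notin> K \<and> (\<forall>j<length gens. j \<noteq> i \<longrightarrow> gens ! j \<in> K)"
proof -
  have points: ?thesis
    if "(gens ! i) P \<noteq> (gens ! i) Q" "\<forall>j<length gens. j \<noteq> i \<longrightarrow> (gens ! j) P = (gens ! j) Q" for P Q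
    using that by (intro exI[of _ "{f. f P = f Q}"] conjI subalgebra_two_points) auto
  note eval = gens_def rel_defs sq_defs eval_nat_numeral All_less_Suc
  consider "i = 0" | "i = 1" | "i = 2" | "i = 3" | "i = 4" | "i = 5" | "i = 6" | "i = 7" | "i = 8"
    | "i = 9" | "i = 10" | "i = 11" | "i = 12" using assms unfolding length_gens by (auto simp: eval_nat_numeral less_Suc_eq)
  then show ?thesis
  proof cases
    case 1 then show ?thesis by (intro points[of "(1, 0, 0, 0, 0)" "(0, 0, 0, 0, 0)"]) (simp_all add: eval)
  next
    case 2 then show ?thesis by (intro points[of "(0, 1, 0, 0, 0)" "(0, 0, 0, 0, 0)"]) (simp_all add: eval)
  next
    case 3 then show ?thesis by (intro points[of "(0, 0, 1, 0, 0)" "(0, 0, 0, 0, 0)"]) (simp_all add: eval)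
  next
    case 4 then show ?thesis by (intro points[of "(0, 0, 0, 1, 0)" "(0, 0, 0, 0, 0)"]) (simp_all add: eval)
  next
    case 5 then show ?thesis by (intro points[of "(0, 0, 1, 1, 0)" "(0, 0, 1, -1, 0)"]) (simp_all add: eval)
  next
    case 6 then show ?thesis by (intro points[of "(0, 0, 0, 0, 1)" "(0, 0, 0, 0, 0)"]) (simp_all add: eval)
  next
    case 7 then show ?thesis by (intro points[of "(0, 0, 1, 0, 1)" "(0, 0, -1, 0, 1)"]) (simp_all add: eval)
  next
    case 9 then show ?thesis by (intro points[of "(0, 0, 0, 1, 1)" "(0, 0, 0, -1, 1)"]) (simp_all add: eval)
  next
    case 10 then show ?thesis by (intro points[of "(0, 0, 1, \<i>, 0)" "(0, 0, 1, -\<i>, 0)"]) (simp_all add: eval)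
  next
    case 11 then show ?thesis by (intro points[of "(0, 0, \<i>, 0, 1)" "(0, 0, -\<i>, 0, 1)"]) (simp_all add: eval)
  next
    case 13 then show ?thesis by (intro points[of "(0, 0, 0, \<i>, 1)" "(0, 0, 0, -\<i>, 1)"]) (simp_all add: eval)
  next
    case 8
    let ?K = "jet_algebra 1"
    have jet: "rel_ux (jet_path 1 r t) = of_real (t ^ 3)" "rel_wx (jet_path 1 r t) = of_real (r * t ^ 4)"
      "rel_wu (jet_path 1 r t) = of_real (r * t ^ 2)" "rel_wux (jet_path 1 r t) = of_real (r * t ^ 3)" for r t
      by (simp_all add: rel_defs jet_path_def eval_nat_numeral)
    have "(\<lambda>(l, m, u, w, z). l) \<in> ?K" "(\<lambda>(l, m, u, w, z). m) \<in> ?K"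
      by (rule in_jet_algebra[of _ _ 0 0 0 0 0]; simp add: jet_path_def)+
    moreover have "(\<lambda>q. 2 * sq_u q) \<in> ?K"
      by (rule in_jet_algebra[of _ _ 2 0 0 0 0]) (simp add: jet_path_def sq_defs)
    moreover have "(\<lambda>q. 8 * sq_w q) \<in> ?K"
      by (rule in_jet_algebra[of _ _ 0 0 0 0 8]) (simp add: jet_path_def sq_defs norm_mult)
    moreover have "(\<lambda>q. 4 * Re (rel_wu q)) \<in> ?K"
      by (rule in_jet_algebra[of _ _ 0 0 4 0 0]) (simp add: jet)
    moreover have "sq_x \<in> ?K"
      by (rule in_jet_algebra[of _ _ 1 0 0 0 0]) (simp add: jet_path_def sq_defs)
    moreover have "(\<lambda>q. Re (rel_ux q)) \<in> ?K"
      by (rule in_jet_algebra[of _ _ 0 1 0 0 0]) (simp add: jet)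
    moreover have "(\<lambda>q. Re (rel_wx q)) \<in> ?K"
      by (rule in_jet_algebra[of _ _ 0 0 0 1 0]) (simp add: jet)
    moreover have "(\<lambda>q. 4 * Im (rel_wu q)) \<in> ?K" "(\<lambda>q. - Im (rel_ux q)) \<in> ?K"
      "(\<lambda>q. 2 * Im (rel_wux q)) \<in> ?K" "(\<lambda>q. - Im (rel_wx q)) \<in> ?K"
      by (rule in_jet_algebra[of _ _ 0 0 0 0 0]; simp add: jet)+
    moreover have "(\<lambda>q. 2 * Re (rel_wux q)) \<notin> ?K"
      by (rule not_in_jet_algebra[of _ _ 2]) (simp_all add: jet)
    ultimately show ?thesis using 8
      by (intro exI[of _ ?K] conjI subalgebra_jet)
         (simp_all add: gens_def eval_nat_numeral All_less_Suc)
  next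
    case 12
    let ?K = "jet_algebra \<i>"
    have jet: "rel_ux (jet_path \<i> r t) = of_real (t ^ 3)" "rel_wx (jet_path \<i> r t) = \<i> * of_real (r * t ^ 4)"
      "rel_wu (jet_path \<i> r t) = \<i> * of_real (r * t ^ 2)" "rel_wux (jet_path \<i> r t) = \<i> * of_real (r * t ^ 3)" for r t
      by (simp_all add: rel_defs jet_path_def eval_nat_numeral)
    have "(\<lambda>(l, m, u, w, z). l) \<in> ?K" "(\<lambda>(l, m, u, w, z). m) \<in> ?K"
      by (rule in_jet_algebra[of _ _ 0 0 0 0 0]; simp add: jet_path_def)+
    moreover have "(\<lambda>q. 2 * sq_u q) \<in> ?K"
      by (rule in_jet_algebra[of _ _ 2 0 0 0 0]) (simp add: jet_path_def sq_defs)
    moreover have "(\<lambda>q. 8 * sq_w q) \<in> ?K"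
      by (rule in_jet_algebra[of _ _ 0 0 0 0 8]) (simp add: jet_path_def sq_defs norm_mult)
    moreover have "sq_x \<in> ?K"
      by (rule in_jet_algebra[of _ _ 1 0 0 0 0]) (simp add: jet_path_def sq_defs)
    moreover have "(\<lambda>q. Re (rel_ux q)) \<in> ?K"
      by (rule in_jet_algebra[of _ _ 0 1 0 0 0]) (simp add: jet)
    moreover have "(\<lambda>q. 4 * Re (rel_wu q)) \<in> ?K" "(\<lambda>q. Re (rel_wx q)) \<in> ?K"
      "(\<lambda>q. 2 * Re (rel_wux q)) \<in> ?K" "(\<lambda>q. - Im (rel_ux q)) \<in> ?K"
      by (rule in_jet_algebra[of _ _ 0 0 0 0 0]; simp add: jet)+
    moreover have "(\<lambda>q. 4 * Im (rel_wu q)) \<in> ?K"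
      by (rule in_jet_algebra[of _ _ 0 0 4 0 0]) (simp add: jet)
    moreover have "(\<lambda>q. - Im (rel_wx q)) \<in> ?K"
      by (rule in_jet_algebra[of _ _ 0 0 0 "-1" 0]) (simp add: jet)
    moreover have "(\<lambda>q. 2 * Im (rel_wux q)) \<notin> ?K"
      by (rule not_in_jet_algebra[of _ _ 2]) (simp_all add: jet)
    ultimately show ?thesis using 12
      by (intro exI[of _ ?K] conjI subalgebra_jet)
         (simp_all add: gens_def eval_nat_numeral All_less_Suc)
  qed
qed

section \<open>Coordinates on pairs of an elasticity tensor and a vector\<close>

definition act_point :: "real^2^2 \<Rightarrow> tensor4 \<times> vec2 \<Rightarrow> tensor4 \<times> vec2" where
  "act_point g = (\<lambda>(C, x). (act4 g C, g *v x))"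

lemma Cov_eq: "Cov Ela act4 G = Inv (Ela \<times> UNIV) act_point G"
proof -
  have "(\<lambda>g (C, x). (act4 g C, g *v x)) = act_point" by (simp add: act_point_def fun_eq_iff)
  then show ?thesis by (simp only: Cov_def)
qed

locale ela_decomposition =
  fixes lam mu :: "tensor4 \<Rightarrow> real" and h :: "tensor4 \<Rightarrow> tensor2" and H :: "tensor4 \<Rightarrow> tensor4"
  assumes decomposition: "harmonic_decomposition (\<lambda>C. (lam C, mu C, h C, H C))"
begin

abbreviation V :: "(tensor4 \<times> vec2) set" where "V \<equiv> Ela \<times> UNIV"

lemma additive:
  assumes "C \<in> Ela" "D \<in> Ela"
  shows "lam (C + D) = lam C + lam D" "mu (C + D) = mu C + mu D" "h (C + D) = h C + h D" "H (C + D) = H C + H D"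
  using assms decomposition by (auto simp: harmonic_decomposition_def)

lemma scaling:
  assumes "C \<in> Ela"
  shows "lam (r *\<^sub>R C) = r * lam C" "mu (r *\<^sub>R C) = r * mu C" "h (r *\<^sub>R C) = r *\<^sub>R h C" "H (r *\<^sub>R C) = r *\<^sub>R H C"
  using assms decomposition by (auto simp: harmonic_decomposition_def)

lemma equivariant:
  assumes "C \<in> Ela" "g \<in> O2"
  shows "lam (act4 g C) = lam C" "mu (act4 g C) = mu C" "h (act4 g C) = act2 g (h C)" "H (act4 g C) = act4 g (H C)"
  using assms decomposition by (auto simp: harmonic_decomposition_def act_dec_def)

lemma bijective: "bij_betw (\<lambda>C. (lam C, mu C, h C, H C)) Ela (UNIV \<times> UNIV \<times> Harm2 \<times> Harm4)"
  using decomposition by (auto simp: harmonic_decomposition_def)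

definition hc :: "tensor4 \<Rightarrow> complex" where "hc C = Complex (h C $ 1 $ 1) (h C $ 1 $ 2)"
definition Hc :: "tensor4 \<Rightarrow> complex" where "Hc C = Complex (H C $ 1 $ 1 $ 1 $ 1) (H C $ 1 $ 1 $ 1 $ 2)"

definition coords_of :: "tensor4 \<times> vec2 \<Rightarrow> coords" where
  "coords_of = (\<lambda>(C, x). (lam C, mu C, hc C, Hc C, vec_cpx x))"

lemma h_eq: "C \<in> Ela \<Longrightarrow> h C = harm2 (hc C)" and H_eq: "C \<in> Ela \<Longrightarrow> H C = harm4 (Hc C)"
  using bij_betw_apply[OF bijective] by (auto simp: hc_def Hc_def intro: Harm2_eq Harm4_eq)

lemma hc_eqI: "h C = harm2 u \<Longrightarrow> hc C = u" and Hc_eqI: "H C = harm4 w \<Longrightarrow> Hc C = w"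
  by (auto simp: hc_def Hc_def)

lemma ela_exists: "\<exists>C\<in>Ela. lam C = l \<and> mu C = m \<and> hc C = u \<and> Hc C = w"
proof -
  have "(l, m, harm2 u, harm4 w) \<in> (\<lambda>C. (lam C, mu C, h C, H C)) ` Ela"
    using bij_betw_imp_surj_on[OF bijective] by (simp add: harm2_in harm4_in)
  then show ?thesis by (force intro: hc_eqI Hc_eqI)
qed

lemma ela_eqI:
  assumes "C \<in> Ela" "D \<in> Ela" "lam C = lam D" "mu C = mu D" "hc C = hc D" "Hc C = Hc D"
  shows "C = D"
  using inj_onD[OF bij_betw_imp_inj_on[OF bijective], of C D] assms by (simp add: h_eq H_eq)

lemma hc_linear: "C \<in> Ela \<Longrightarrow> D \<in> Ela \<Longrightarrow> hc (C + D) = hc C + hc D"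
  "C \<in> Ela \<Longrightarrow> hc (r *\<^sub>R C) = of_real r * hc C"
  "C \<in> Ela \<Longrightarrow> D \<in> Ela \<Longrightarrow> Hc (C + D) = Hc C + Hc D"
  "C \<in> Ela \<Longrightarrow> Hc (r *\<^sub>R C) = of_real r * Hc C"
  by (simp_all add: hc_def Hc_def additive scaling complex_eq_iff)

lemma coords_of_surj: "\<exists>v\<in>V. coords_of v = q"
proof -
  obtain l m u w z where q: "q = (l, m, u, w, z)" by (cases q)
  obtain C where "C \<in> Ela" "lam C = l" "mu C = m" "hc C = u" "Hc C = w" using ela_exists by blast
  moreover have "vec_cpx (vector [Re z, Im z]) = z" by (simp add: vec_cpx_def)
  ultimately show ?thesis by (intro bexI[of _ "(C, vector [Re z, Im z])"]) (simp_all add: coords_of_def q)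
qed

lemma act_point_in: "v \<in> V \<Longrightarrow> act_point g v \<in> V"
  by (auto simp: act_point_def act4_Ela)

lemma coords_of_rotation:
  assumes "v \<in> V" "cmod e = 1"
  shows "coords_of (act_point (rotation e) v) = turn e (coords_of v)"
proof -
  obtain C x where v: "v = (C, x)" and C: "C \<in> Ela" using assms(1) by auto
  have g: "rotation e \<in> O2" using rotation_in_SO2[OF assms(2)] by (simp add: rotation_matrix_def)
  have "hc (act4 (rotation e) C) = e^2 * hc C" "Hc (act4 (rotation e) C) = e^4 * Hc C"
    by (rule hc_eqI Hc_eqI; simp only: equivariant[OF C g] h_eq[OF C] H_eq[OF C] act_rotation)+
  then show ?thesis
    using equivariant[OF C g] by (simp add: v coords_of_def act_point_def turn_def vec_cpx_rotation)
qed

lemma coords_of_reflection: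
  assumes "v \<in> V" "cmod e = 1"
  shows "coords_of (act_point (reflection e) v) = turn e (mirror (coords_of v))"
proof -
  obtain C x where v: "v = (C, x)" and C: "C \<in> Ela" using assms(1) by auto
  have g: "reflection e \<in> O2" using reflection_in_O2[OF assms(2)] .
  have "hc (act4 (reflection e) C) = e^2 * cnj (hc C)" "Hc (act4 (reflection e) C) = e^4 * cnj (Hc C)"
    by (rule hc_eqI Hc_eqI; simp only: equivariant[OF C g] h_eq[OF C] H_eq[OF C] act_reflection)+
  then show ?thesis
    using equivariant[OF C g] by (simp add: v coords_of_def act_point_def turn_def mirror_def vec_cpx_reflection)
qed

lemma coords_of_scale: "v \<in> V \<Longrightarrow> coords_of (t *\<^sub>R v) = dilate t (coords_of v)"
  by (auto simp: coords_of_def dilate_def scaling hc_linear vec_cpx_def complex_eq_iff)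

section \<open>Polynomials in coordinates\<close>

definition pullback :: "(coords \<Rightarrow> real) \<Rightarrow> tensor4 \<times> vec2 \<Rightarrow> real" where
  "pullback f = restrict (\<lambda>v. f (coords_of v)) V"

lemma pullback_apply: "v \<in> V \<Longrightarrow> pullback f v = f (coords_of v)"
  by (simp add: pullback_def)

lemma pullback_inject: "pullback f = pullback g \<longleftrightarrow> f = g"
proof
  assume eq: "pullback f = pullback g"
  show "f = g"
  proof
    fix q
    obtain v where "v \<in> V" "coords_of v = q" using coords_of_surj by blast
    then show "f q = g q" using fun_cong[OF eq, of v] by (simp add: pullback_apply)
  qed
qed simp

lemma poly_real_basic:
  "poly_fun (\<lambda>q. of_real c)" "poly_fun (\<lambda>(l, m, u, w, z). of_real l)" "poly_fun (\<lambda>(l, m, u, w, z). of_real m)"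
  "poly_fun (\<lambda>(l, m, u, w, z). of_real (Re u))" "poly_fun (\<lambda>(l, m, u, w, z). of_real (Im u))"
  "poly_fun (\<lambda>(l, m, u, w, z). of_real (Re w))" "poly_fun (\<lambda>(l, m, u, w, z). of_real (Im w))"
  "poly_fun (\<lambda>(l, m, u, w, z). of_real (Re z))" "poly_fun (\<lambda>(l, m, u, w, z). of_real (Im z))"
proof -
  have eqI: "poly_fun f" if "poly_fun g" "\<And>l m u w z. f (l, m, u, w, z) = g (l, m, u, w, z)" for f g :: "coords \<Rightarrow> complex"
  proof -
    have "f = g" using that(2) by auto
    then show ?thesis using that(1) by simp
  qed
  show "poly_fun (\<lambda>q. of_real c)"
    by (rule eqI[OF poly_fun.mon[of "of_real c" 0 0 0 0 0 0 0 0]]) (simp add: mon_def)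
  show "poly_fun (\<lambda>(l, m, u, w, z). of_real l)"
    by (rule eqI[OF poly_fun.mon[of 1 1 0 0 0 0 0 0 0]]) (simp add: mon_def)
  show "poly_fun (\<lambda>(l, m, u, w, z). of_real m)"
    by (rule eqI[OF poly_fun.mon[of 1 0 1 0 0 0 0 0 0]]) (simp add: mon_def)
  show "poly_fun (\<lambda>(l, m, u, w, z). of_real (Re u))"
    by (rule eqI[OF poly_fun.add[OF poly_fun.mon[of "1/2" 0 0 1 0 0 0 0 0] poly_fun.mon[of "1/2" 0 0 0 1 0 0 0 0]]])
       (simp add: mon_def complex_eq_iff)
  show "poly_fun (\<lambda>(l, m, u, w, z). of_real (Im u))"
    by (rule eqI[OF poly_fun.add[OF poly_fun.mon[of "-\<i>/2" 0 0 1 0 0 0 0 0] poly_fun.mon[of "\<i>/2" 0 0 0 1 0 0 0 0]]])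
       (simp add: mon_def complex_eq_iff)
  show "poly_fun (\<lambda>(l, m, u, w, z). of_real (Re w))"
    by (rule eqI[OF poly_fun.add[OF poly_fun.mon[of "1/2" 0 0 0 0 1 0 0 0] poly_fun.mon[of "1/2" 0 0 0 0 0 1 0 0]]])
       (simp add: mon_def complex_eq_iff)
  show "poly_fun (\<lambda>(l, m, u, w, z). of_real (Im w))"
    by (rule eqI[OF poly_fun.add[OF poly_fun.mon[of "-\<i>/2" 0 0 0 0 1 0 0 0] poly_fun.mon[of "\<i>/2" 0 0 0 0 0 1 0 0]]])
       (simp add: mon_def complex_eq_iff)
  show "poly_fun (\<lambda>(l, m, u, w, z). of_real (Re z))"
    by (rule eqI[OF poly_fun.add[OF poly_fun.mon[of "1/2" 0 0 0 0 0 0 1 0] poly_fun.mon[of "1/2" 0 0 0 0 0 0 0 1]]])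
       (simp add: mon_def complex_eq_iff)
  show "poly_fun (\<lambda>(l, m, u, w, z). of_real (Im z))"
    by (rule eqI[OF poly_fun.add[OF poly_fun.mon[of "-\<i>/2" 0 0 0 0 0 0 1 0] poly_fun.mon[of "\<i>/2" 0 0 0 0 0 0 0 1]]])
       (simp add: mon_def complex_eq_iff)
qed

text \<open>The harmonic decomposition is additive and homogeneous on \<open>Ela\<close>, so \<open>C\<close> is the combination, with
its own coordinates as coefficients, of the six tensors that correspond to the unit coordinates.\<close>

lemma linear_form_in_coords:
  assumes "bounded_linear f"
  obtains a b c d c' d' p q :: real where
    "\<And>v. v \<in> V \<Longrightarrow> f v = (case coords_of v of (l, m, u, w, z) \<Rightarrow>
       a * l + b * m + c * Re u + d * Im u + c' * Re w + d' * Im w + p * Re z + q * Im z)"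
proof -
  interpret bounded_linear f by fact
  obtain A where A: "A \<in> Ela" "lam A = 1" "mu A = 0" "hc A = 0" "Hc A = 0" using ela_exists by blast
  obtain B where B: "B \<in> Ela" "lam B = 0" "mu B = 1" "hc B = 0" "Hc B = 0" using ela_exists by blast
  obtain C where C: "C \<in> Ela" "lam C = 0" "mu C = 0" "hc C = 1" "Hc C = 0" using ela_exists by blast
  obtain D where D: "D \<in> Ela" "lam D = 0" "mu D = 0" "hc D = \<i>" "Hc D = 0" using ela_exists by blast
  obtain E where E: "E \<in> Ela" "lam E = 0" "mu E = 0" "hc E = 0" "Hc E = 1" using ela_exists by blast
  obtain F where F: "F \<in> Ela" "lam F = 0" "mu F = 0" "hc F = 0" "Hc F = \<i>" using ela_exists by blast
  show thesis
  proof (rule that)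
    fix v assume "v \<in> V"
    then obtain T x where v: "v = (T, x)" and T: "T \<in> Ela" by auto
    have "T = lam T *\<^sub>R A + mu T *\<^sub>R B + Re (hc T) *\<^sub>R C + Im (hc T) *\<^sub>R D + Re (Hc T) *\<^sub>R E + Im (Hc T) *\<^sub>R F"
      by (rule ela_eqI)
         (simp_all add: T A B C D E F Ela_add Ela_scale additive scaling hc_linear complex_eq_iff)
    moreover have "x = (x $ 1) *\<^sub>R axis 1 1 + (x $ 2) *\<^sub>R axis 2 1"
      by (simp add: vec_eq_iff forall_2 axis_def)
    ultimately have "v = lam T *\<^sub>R (A, 0) + mu T *\<^sub>R (B, 0) + Re (hc T) *\<^sub>R (C, 0) + Im (hc T) *\<^sub>R (D, 0)
      + Re (Hc T) *\<^sub>R (E, 0) + Im (Hc T) *\<^sub>R (F, 0) + (x $ 1) *\<^sub>R (0, axis 1 1) + (x $ 2) *\<^sub>R (0, axis 2 1)"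
      by (simp add: v)
    then have "f v = f (lam T *\<^sub>R (A, 0) + mu T *\<^sub>R (B, 0) + Re (hc T) *\<^sub>R (C, 0) + Im (hc T) *\<^sub>R (D, 0)
      + Re (Hc T) *\<^sub>R (E, 0) + Im (Hc T) *\<^sub>R (F, 0) + (x $ 1) *\<^sub>R (0, axis 1 1) + (x $ 2) *\<^sub>R (0, axis 2 1))"
      by (rule arg_cong)
    then show "f v = (case coords_of v of (l, m, u, w, z) \<Rightarrow>
       f (A, 0) * l + f (B, 0) * m + f (C, 0) * Re u + f (D, 0) * Im u + f (E, 0) * Re w + f (F, 0) * Im w
         + f (0, axis 1 1) * Re z + f (0, axis 2 1) * Im z)"
      unfolding add scaleR by (simp add: v coords_of_def vec_cpx_def mult.commute)
  qed
qed

lemma polynomial_in_coords: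
  assumes "real_polynomial_function p"
  shows "\<exists>f. poly_fun (\<lambda>q. of_real (f q)) \<and> (\<forall>v\<in>V. p v = f (coords_of v))"
  using assms
proof induction
  case (linear f)
  then obtain a b c d c' d' p q where f: "\<And>v. v \<in> V \<Longrightarrow> f v = (case coords_of v of (l, m, u, w, z) \<Rightarrow>
       a * l + b * m + c * Re u + d * Im u + c' * Re w + d' * Im w + p * Re z + q * Im z)"
    using linear_form_in_coords by blast
  let ?f = "\<lambda>(l, m, u, w, z). a * l + b * m + c * Re u + d * Im u + c' * Re w + d' * Im w + p * Re z + q * Im z"
  have "poly_fun (\<lambda>q. of_real (?f q))"
    using poly_real_basic unfolding case_prod_unfold of_real_add of_real_mult
    by (intro poly_fun.add poly_fun_mult)
  with f show ?case by blast
next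
  case (const c)
  show ?case by (intro exI[of _ "\<lambda>q. c"]) (simp add: poly_real_basic)
next
  case (add p1 p2)
  then obtain f g where "poly_fun (\<lambda>q. of_real (f q))" "\<forall>v\<in>V. p1 v = f (coords_of v)"
    "poly_fun (\<lambda>q. of_real (g q))" "\<forall>v\<in>V. p2 v = g (coords_of v)" by blast
  then show ?case by (intro exI[of _ "\<lambda>q. f q + g q"]) (simp add: poly_fun.add)
next
  case (mult p1 p2)
  then obtain f g where "poly_fun (\<lambda>q. of_real (f q))" "\<forall>v\<in>V. p1 v = f (coords_of v)"
    "poly_fun (\<lambda>q. of_real (g q))" "\<forall>v\<in>V. p2 v = g (coords_of v)" by blast
  then show ?case by (intro exI[of _ "\<lambda>q. f q * g q"]) (simp add: poly_fun_mult)
qed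

definition is_poly :: "(coords \<Rightarrow> real) \<Rightarrow> bool" where
  "is_poly f \<longleftrightarrow> pullback f \<in> polynomials_on V"

lemma is_polyI: "real_polynomial_function p \<Longrightarrow> (\<And>v. v \<in> V \<Longrightarrow> f (coords_of v) = p v) \<Longrightarrow> is_poly f"
  unfolding is_poly_def polynomials_on_def pullback_def by (auto intro!: exI[of _ p])

lemma is_polyE:
  assumes "is_poly f" obtains p where "real_polynomial_function p" "\<And>v. v \<in> V \<Longrightarrow> f (coords_of v) = p v"
  using assms unfolding is_poly_def polynomials_on_def pullback_def by (auto simp: fun_eq_iff restrict_def) metis

lemma is_poly_const: "is_poly (\<lambda>q. c)"
  by (rule is_polyI[OF real_polynomial_function.intros(2)]) simp

lemma is_poly_add: "is_poly f \<Longrightarrow> is_poly g \<Longrightarrow> is_poly (\<lambda>q. f q + g q)"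
  by (elim is_polyE, rule is_polyI[OF real_polynomial_function.intros(3)]) auto

lemma is_poly_mult: "is_poly f \<Longrightarrow> is_poly g \<Longrightarrow> is_poly (\<lambda>q. f q * g q)"
  by (elim is_polyE, rule is_polyI[OF real_polynomial_function.intros(4)]) auto

sublocale polys: real_function_algebra is_poly
  by unfold_locales (simp_all add: is_poly_const is_poly_add is_poly_mult)

text \<open>The hypothesis only controls \<open>f\<close> on \<open>Ela\<close>; the polynomial required on the ambient space is \<open>f\<close>
composed with the projection.\<close>

lemma is_poly_linear:
  assumes add: "\<And>C D. C \<in> Ela \<Longrightarrow> D \<in> Ela \<Longrightarrow> f (C + D) = f C + f D"
    and scale: "\<And>C r. C \<in> Ela \<Longrightarrow> f (r *\<^sub>R C) = r * f C"
    and g: "\<And>C x. C \<in> Ela \<Longrightarrow> g (coords_of (C, x)) = f C"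
  shows "is_poly g"
proof (rule is_polyI)
  have "linear (\<lambda>v :: tensor4 \<times> vec2. f (proj_Ela (fst v)))"
    by (rule linearI) (simp_all add: linear_add[OF linear_proj_Ela] linear_scale[OF linear_proj_Ela] add scale proj_Ela_in)
  then show "real_polynomial_function (\<lambda>v :: tensor4 \<times> vec2. f (proj_Ela (fst v)))"
    by (intro real_polynomial_function.intros) (simp add: linear_conv_bounded_linear)
qed (auto simp: g proj_Ela_id)

lemma is_poly_coords:
  "is_poly (\<lambda>(l, m, u, w, z). l)" "is_poly (\<lambda>(l, m, u, w, z). m)"
  "is_poly (\<lambda>(l, m, u, w, z). Re u)" "is_poly (\<lambda>(l, m, u, w, z). Im u)"
  "is_poly (\<lambda>(l, m, u, w, z). Re w)" "is_poly (\<lambda>(l, m, u, w, z). Im w)"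
  "is_poly (\<lambda>(l, m, u, w, z). Re z)" "is_poly (\<lambda>(l, m, u, w, z). Im z)"
proof -
  show "is_poly (\<lambda>(l, m, u, w, z). l)" by (rule is_poly_linear[of lam]) (simp_all add: additive scaling coords_of_def)
  show "is_poly (\<lambda>(l, m, u, w, z). m)" by (rule is_poly_linear[of mu]) (simp_all add: additive scaling coords_of_def)
  show "is_poly (\<lambda>(l, m, u, w, z). Re u)" by (rule is_poly_linear[of "\<lambda>C. Re (hc C)"]) (simp_all add: hc_linear coords_of_def)
  show "is_poly (\<lambda>(l, m, u, w, z). Im u)" by (rule is_poly_linear[of "\<lambda>C. Im (hc C)"]) (simp_all add: hc_linear coords_of_def)
  show "is_poly (\<lambda>(l, m, u, w, z). Re w)" by (rule is_poly_linear[of "\<lambda>C. Re (Hc C)"]) (simp_all add: hc_linear coords_of_def)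
  show "is_poly (\<lambda>(l, m, u, w, z). Im w)" by (rule is_poly_linear[of "\<lambda>C. Im (Hc C)"]) (simp_all add: hc_linear coords_of_def)
  have "linear (\<lambda>v :: tensor4 \<times> vec2. snd v $ i)" for i by (rule linearI) simp_all
  then have "real_polynomial_function (\<lambda>v :: tensor4 \<times> vec2. snd v $ i)" for i
    by (intro real_polynomial_function.intros) (simp add: linear_conv_bounded_linear)
  from is_polyI[OF this[of 1]] is_polyI[OF this[of 2]]
  show "is_poly (\<lambda>(l, m, u, w, z). Re z)" "is_poly (\<lambda>(l, m, u, w, z). Im z)"
    by (auto simp: coords_of_def vec_cpx_def)
qed

lemma is_poly_gens: "f \<in> set gens \<Longrightarrow> is_poly f"
proof -
  define cp where "cp k \<longleftrightarrow> is_poly (\<lambda>q. Re (k q)) \<and> is_poly (\<lambda>q. Im (k q))" for k :: "coords \<Rightarrow> complex"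
  have cp_mult: "cp (\<lambda>q. k q * k' q)" if "cp k" "cp k'" for k k'
    using that by (auto simp: cp_def intro!: polys.R_diff polys.R_add polys.R_mult)
  have cp_cnj: "cp (\<lambda>q. cnj (k q))" if "cp k" for k
    using that by (auto simp: cp_def intro!: polys.R_uminus)
  have cp_power: "cp (\<lambda>q. k q ^ n)" if "cp k" for k n
    by (induction n) (auto intro: cp_mult that simp: cp_def[of "\<lambda>q. 1"] polys.R_const)
  have u: "cp (\<lambda>(l, m, u, w, z). u)" and w: "cp (\<lambda>(l, m, u, w, z). w)" and z: "cp (\<lambda>(l, m, u, w, z). z)"
    using is_poly_coords by (simp_all add: cp_def case_prod_unfold)
  note uwz = u[unfolded case_prod_unfold] w[unfolded case_prod_unfold] z[unfolded case_prod_unfold]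
  have rel: "cp rel_ux" "cp rel_wx" "cp rel_wu" "cp rel_wux"
    unfolding rel_defs case_prod_unfold by (intro cp_mult cp_cnj cp_power uwz)+
  have sq: "is_poly sq_u" "is_poly sq_w" "is_poly sq_x"
    unfolding sq_defs cmod_power2 case_prod_unfold using is_poly_coords
    by (intro polys.R_add polys.R_power; simp add: case_prod_unfold)+
  have "list_all is_poly gens"
    unfolding gens_def list.pred_inject(2) using rel sq is_poly_coords
    by (intro conjI list.pred_inject(1)) (auto simp: cp_def intro: polys.R_cmult polys.R_uminus)
  then show "f \<in> set gens \<Longrightarrow> is_poly f" by (simp add: list_all_iff)
qed

section \<open>Integrity bases\<close>

lemma pullback_in_Inv:
  assumes "is_poly f" and "\<And>g v. g \<in> G \<Longrightarrow> v \<in> V \<Longrightarrow> f (coords_of (act_point g v)) = f (coords_of v)"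
  shows "pullback f \<in> Inv V act_point G"
  unfolding Inv_def
proof (intro CollectI conjI ballI)
  show "pullback f \<in> polynomials_on V" using assms(1) by (simp add: is_poly_def)
  fix g v assume gv: "g \<in> G" "v \<in> V"
  show "pullback f (act_point g v) = pullback f v"
    by (simp only: pullback_apply gv act_point_in assms(2))
qed

lemma pullback_algebra: "real_function_algebra (\<lambda>f. pullback f \<in> algebra_generated V B)"
proof
  show "pullback (\<lambda>q. k) \<in> algebra_generated V B" for k
    unfolding pullback_def by (rule algebra_generated.const)
next
  fix f g assume fg: "pullback f \<in> algebra_generated V B" "pullback g \<in> algebra_generated V B"
  have "(\<lambda>v\<in>V. pullback f v + pullback g v) = pullback (\<lambda>q. f q + g q)"
    "(\<lambda>v\<in>V. pullback f v * pullback g v) = pullback (\<lambda>q. f q * g q)"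
    by (auto simp: pullback_def)
  then show "pullback (\<lambda>q. f q + g q) \<in> algebra_generated V B" "pullback (\<lambda>q. f q * g q) \<in> algebra_generated V B"
    using algebra_generated.add[OF fg] algebra_generated.mult[OF fg] by simp_all
qed

lemma homogeneous_pullback:
  assumes "f \<in> set gens" shows "homogeneous_on V (pullback f)"
proof -
  obtain d where "\<forall>q t. f (dilate t q) = t ^ d * f q" using gens_homogeneous[OF assms] by blast
  moreover have "t *\<^sub>R v \<in> V" if "v \<in> V" for t v using that by (auto simp: Ela_scale)
  ultimately have "\<forall>v\<in>V. \<forall>t. pullback f (t *\<^sub>R v) = t ^ d * pullback f v"
    by (metis pullback_apply coords_of_scale)
  then show ?thesis unfolding homogeneous_on_def by blast
qed

lemma coords_of_SO2:
  assumes "g \<in> SO2" "v \<in> V"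
  obtains e where "cmod e = 1" "coords_of (act_point g v) = turn e (coords_of v)"
proof -
  have "orthogonal_matrix g" "det g = 1" using assms(1) by (auto simp: rotation_matrix_def)
  from this(1) show thesis
    by (cases rule: orthogonal_2_cases) (use \<open>det g = 1\<close> coords_of_rotation assms(2) that in auto)
qed

lemma coords_of_O2:
  assumes "g \<in> O2" "v \<in> V"
  obtains e where "cmod e = 1" "coords_of (act_point g v) = turn e (coords_of v)"
  | e where "cmod e = 1" "coords_of (act_point g v) = turn e (mirror (coords_of v))"
proof -
  have "orthogonal_matrix g" using assms(1) by auto
  then show thesis
    by (cases rule: orthogonal_2_cases) (use coords_of_rotation coords_of_reflection assms(2) that in auto)
qed

text \<open>Since the coordinates are onto, invariance under the group becomes invariance of the
coordinate expression at every point, for unit rotation numbers and for conjugation.\<close>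

lemma invariant_in_coords:
  assumes "p \<in> Inv V act_point G"
  obtains f where "p = pullback f" "poly_fun (\<lambda>q. of_real (f q))"
    "\<And>e q. rotation e \<in> G \<Longrightarrow> cmod e = 1 \<Longrightarrow> f (turn e q) = f q"
    "\<And>q. reflection 1 \<in> G \<Longrightarrow> f (mirror q) = f q"
proof -
  obtain p' where p': "real_polynomial_function p'" "p = restrict p' V"
    using assms by (auto simp: Inv_def polynomials_on_def)
  obtain f where f: "poly_fun (\<lambda>q. of_real (f q))" "\<forall>v\<in>V. p' v = f (coords_of v)"
    using polynomial_in_coords[OF p'(1)] by blast
  have p: "p = pullback f" using f(2) by (auto simp: p'(2) pullback_def)
  have inv: "f (coords_of (act_point g v)) = f (coords_of v)" if "g \<in> G" "v \<in> V" for g v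
  proof -
    have "p (act_point g v) = p v" using assms that unfolding Inv_def by blast
    then show ?thesis by (simp only: p pullback_apply[OF that(2)] pullback_apply[OF act_point_in[OF that(2)]])
  qed
  show thesis
  proof (rule that[OF p f(1)])
    fix e q assume e: "rotation e \<in> G" "cmod e = 1"
    obtain v where "v \<in> V" "coords_of v = q" using coords_of_surj by blast
    then show "f (turn e q) = f q" using inv[OF e(1), of v] coords_of_rotation[OF _ e(2), of v] by simp
  next
    fix q assume G: "reflection 1 \<in> G"
    obtain v where "v \<in> V" "coords_of v = q" using coords_of_surj by blast
    moreover have "turn 1 q = q" for q by (simp add: turn_def split_beta)
    ultimately show "f (mirror q) = f q" using inv[OF G, of v] coords_of_reflection[of v 1] by simp
  qed
qed

lemma integrity_basisI:
  assumes fs: "set fs \<subseteq> set gens"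
    and inv: "\<And>f g v. f \<in> set fs \<Longrightarrow> g \<in> G \<Longrightarrow> v \<in> V \<Longrightarrow> f (coords_of (act_point g v)) = f (coords_of v)"
    and gen: "\<And>p. p \<in> Inv V act_point G \<Longrightarrow> p \<in> algebra_generated V (pullback ` set fs)"
  shows "integrity_basis V (Cov Ela act4 G) (set (map pullback fs))"
  unfolding integrity_basis_def Cov_eq
proof (intro conjI ballI)
  show sub: "set (map pullback fs) \<subseteq> Inv V act_point G"
    using fs inv is_poly_gens by (auto intro!: pullback_in_Inv)
  show "algebra_generated V (set (map pullback fs)) = Inv V act_point G"
    using algebra_generated_least[OF subalgebra_on_Inv sub] act_point_in gen by auto
qed (use fs homogeneous_pullback in auto)

lemma basis_SO2: "integrity_basis V (Cov Ela act4 SO2) (set (map pullback gens))"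
proof (rule integrity_basisI)
  fix f g v assume "f \<in> set gens" "g \<in> SO2" "v \<in> V"
  then show "f (coords_of (act_point g v)) = f (coords_of v)"
    by (metis coords_of_SO2 gens_turn)
next
  fix p assume "p \<in> Inv V act_point SO2"
  then obtain f where f: "p = pullback f" "poly_fun (\<lambda>q. of_real (f q))"
    "\<And>e q. rotation e \<in> SO2 \<Longrightarrow> cmod e = 1 \<Longrightarrow> f (turn e q) = f q"
    by (rule invariant_in_coords) blast
  interpret SO2_algebra "\<lambda>f. pullback f \<in> algebra_generated V (pullback ` set gens)"
    by (intro SO2_algebra_from_gens pullback_algebra) (auto intro: algebra_generated.gen)
  show "p \<in> algebra_generated V (pullback ` set gens)"
    unfolding f(1) using f(2,3) rotation_in_SO2 by (intro R_SO2_invariant) auto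
qed simp

lemma basis_O2: "integrity_basis V (Cov Ela act4 O2) (set (map pullback (take 9 gens)))"
proof (rule integrity_basisI)
  fix f g v assume "f \<in> set (take 9 gens)" "g \<in> O2" "v \<in> V"
  then show "f (coords_of (act_point g v)) = f (coords_of v)"
    by (metis coords_of_O2 gens_turn gens_mirror in_set_takeD)
next
  fix p assume "p \<in> Inv V act_point O2"
  then obtain f where f: "p = pullback f" "poly_fun (\<lambda>q. of_real (f q))"
    "\<And>e q. rotation e \<in> O2 \<Longrightarrow> cmod e = 1 \<Longrightarrow> f (turn e q) = f q"
    "\<And>q. reflection 1 \<in> O2 \<Longrightarrow> f (mirror q) = f q"
    by (rule invariant_in_coords) blast
  interpret O2_algebra "\<lambda>f. pullback f \<in> algebra_generated V (pullback ` set (take 9 gens))"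
    by (intro O2_algebra_from_gens pullback_algebra) (auto intro: algebra_generated.gen)
  have "rotation e \<in> O2" if "cmod e = 1" for e using rotation_in_SO2[OF that] by (simp add: rotation_matrix_def)
  then show "p \<in> algebra_generated V (pullback ` set (take 9 gens))"
    unfolding f(1) using f(2,3,4) reflection_in_O2[of 1] by (intro R_O2_invariant) auto
qed (rule set_take_subset)

lemma pullback_separated:
  assumes "i < length gens"
  shows "\<exists>K. subalgebra_on V K \<and> pullback (gens ! i) \<notin> K \<and> (\<forall>j<length gens. j \<noteq> i \<longrightarrow> pullback (gens ! j) \<in> K)"
proof -
  obtain K where K: "subalgebra_on UNIV K" "gens ! i \<notin> K" "\<And>j. j < length gens \<Longrightarrow> j \<noteq> i \<Longrightarrow> gens ! j \<in> K"
    using gens_separated[OF assms] by blast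
  have "(\<lambda>v\<in>V. pullback f v + pullback g v) = pullback (\<lambda>q. f q + g q)"
    "(\<lambda>v\<in>V. pullback f v * pullback g v) = pullback (\<lambda>q. f q * g q)"
    "(\<lambda>v\<in>V. c) = pullback (\<lambda>q. c)" for f g c
    by (auto simp: pullback_def)
  then have "subalgebra_on V (pullback ` K)"
    using K(1) unfolding subalgebra_on_def restrict_UNIV by auto
  moreover have "pullback (gens ! i) \<notin> pullback ` K" using K(2) by (auto simp: pullback_inject)
  ultimately show ?thesis using K(3) by blast
qed

lemma minimal_prefix:
  assumes "integrity_basis V A (set (map pullback (take n gens)))" "n \<le> length gens"
  shows "minimal_integrity_basis V A (set (map pullback (take n gens)))" "distinct (map pullback (take n gens))"
proof -
  have sep: "\<exists>K. subalgebra_on V K \<and> map pullback (take n gens) ! i \<notin> K \<and>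
      (\<forall>j<length (map pullback (take n gens)). j \<noteq> i \<longrightarrow> map pullback (take n gens) ! j \<in> K)"
    if "i < length (map pullback (take n gens))" for i
  proof -
    from that assms(2) have "i < length gens" "i < n" by simp_all
    then obtain K where "subalgebra_on V K" "pullback (gens ! i) \<notin> K"
      "\<forall>j<length gens. j \<noteq> i \<longrightarrow> pullback (gens ! j) \<in> K"
      using pullback_separated by blast
    then show ?thesis using \<open>i < n\<close> assms(2) by (intro exI[of _ K]) simp
  qed
  show "minimal_integrity_basis V A (set (map pullback (take n gens)))"
    by (rule separated_minimal[OF sep assms(1)])
  show "distinct (map pullback (take n gens))"
    by (rule separated_distinct[OF sep])
qed

section \<open>The orders of the generators\<close>

text \<open>Scaling \<open>x\<close> scales \<open>z\<close> and nothing else.\<close>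

lemma has_order_0_pullback:
  "has_order Ela 0 (pullback f) \<longleftrightarrow> (\<forall>l m u w z t. f (l, m, u, w, of_real t * z) = f (l, m, u, w, z))"
proof
  assume ord: "has_order Ela 0 (pullback f)"
  show "\<forall>l m u w z t. f (l, m, u, w, of_real t * z) = f (l, m, u, w, z)"
  proof (intro allI)
    fix l m u w z t
    obtain C x where C: "C \<in> Ela" and q: "coords_of (C, x) = (l, m, u, w, z)" using coords_of_surj by blast
    have "coords_of (C, t *\<^sub>R x) = (l, m, u, w, of_real t * z)"
      using q by (auto simp: coords_of_def vec_cpx_def complex_eq_iff)
    moreover have "f (coords_of (C, t *\<^sub>R x)) = f (coords_of (C, x))"
      using ord C by (simp add: has_order_def pullback_def)
    ultimately show "f (l, m, u, w, of_real t * z) = f (l, m, u, w, z)" by (simp only: q)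
  qed
next
  assume f: "\<forall>l m u w z t. f (l, m, u, w, of_real t * z) = f (l, m, u, w, z)"
  have "vec_cpx (t *\<^sub>R x) = of_real t * vec_cpx x" for t x by (simp add: vec_cpx_def complex_eq_iff)
  with f show "has_order Ela 0 (pullback f)"
    by (auto simp: has_order_def pullback_def coords_of_def)
qed

lemma orders_of_gens:
  "map (\<lambda>f. has_order Ela 0 (pullback f)) gens =
     [True, True, True, True, True, False, False, False, False, True, False, False, False]"
proof -
  have not_0: "\<not> has_order Ela 0 (pullback f)"
    \<comment> \<open>At this point the real and imaginary parts of \<open>u\<close>, \<open>w\<close> and \<open>w cnj u\<close> are all nonzero.\<close>
    if "f (0, 0, Complex 1 2, Complex 1 1, of_real 0 * 1) \<noteq> f (0, 0, Complex 1 2, Complex 1 1, 1)" for f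
    using that unfolding has_order_0_pullback by blast
  have "has_order Ela 0 (pullback (\<lambda>(l, m, u, w, z). l))" "has_order Ela 0 (pullback (\<lambda>(l, m, u, w, z). m))"
    "has_order Ela 0 (pullback (\<lambda>q. 2 * sq_u q))" "has_order Ela 0 (pullback (\<lambda>q. 8 * sq_w q))"
    "has_order Ela 0 (pullback (\<lambda>q. 4 * Re (rel_wu q)))" "has_order Ela 0 (pullback (\<lambda>q. 4 * Im (rel_wu q)))"
    by (simp_all add: has_order_0_pullback sq_defs rel_defs)
  moreover have "\<not> has_order Ela 0 (pullback sq_x)" "\<not> has_order Ela 0 (pullback (\<lambda>q. Re (rel_ux q)))"
    "\<not> has_order Ela 0 (pullback (\<lambda>q. 2 * Re (rel_wux q)))" "\<not> has_order Ela 0 (pullback (\<lambda>q. Re (rel_wx q)))"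
    "\<not> has_order Ela 0 (pullback (\<lambda>q. - Im (rel_ux q)))" "\<not> has_order Ela 0 (pullback (\<lambda>q. 2 * Im (rel_wux q)))"
    "\<not> has_order Ela 0 (pullback (\<lambda>q. - Im (rel_wx q)))"
    by (rule not_0; simp add: sq_defs rel_defs)+
  ultimately show ?thesis by (simp add: gens_def)
qed

lemma card_order_0:
  assumes "distinct (map pullback fs)"
  shows "card {c \<in> set (map pullback fs). has_order Ela 0 c} =
    length (filter id (map (\<lambda>f. has_order Ela 0 (pullback f)) fs))"
proof -
  have "{c \<in> set (map pullback fs). has_order Ela 0 c} = set (filter (has_order Ela 0) (map pullback fs))" by auto
  also have "card \<dots> = length (filter (has_order Ela 0) (map pullback fs))"
    using assms by (intro distinct_card distinct_filter)
  finally show ?thesis by (simp add: filter_map o_def)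
qed

lemma pullback_gens:
  "map pullback gens =
    [cov0 lam, cov0 mu,
     cov0 (\<lambda>C. ddot22 (h C) (h C)),
     cov0 (\<lambda>C. qdot44 (H C) (H C)),
     cov0 (\<lambda>C. ddot22 (h C) (ddot42 (H C) (h C))),
     cov2 (\<lambda>C. id_tensor),
     cov2 h,
     cov2 (\<lambda>C. ddot42 (H C) (h C)),
     cov4 H,
     cov0 (\<lambda>C. ddot22 (h C) (ddot42 (H C) (cross22 id_tensor (h C)))),
     cov2 (\<lambda>C. cross22 id_tensor (h C)),
     cov2 (\<lambda>C. ddot42 (H C) (cross22 id_tensor (h C))),
     cov4 (\<lambda>C. cross24 id_tensor (H C))]"
proof -
  have eqI: "pullback f = restrict c V" if "\<And>C x. C \<in> Ela \<Longrightarrow> f (coords_of (C, x)) = c (C, x)" for f c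
    using that by (auto simp: pullback_def)
  note harm = h_eq H_eq ddot22_harm ddot42_harm qdot44_harm cross22_harm cross24_harm
    harm2_form harm4_form id_form
  note coords = coords_of_def sq_defs rel_defs prod.case
  have Re_Im: "Re (\<i> * x) = - Im x" for x by simp
  have 1: "pullback (\<lambda>(l, m, u, w, z). l) = cov0 lam" "pullback (\<lambda>(l, m, u, w, z). m) = cov0 mu"
    unfolding cov0_def by (rule eqI; simp add: coords_of_def)+
  have 2: "pullback (\<lambda>q. 2 * sq_u q) = cov0 (\<lambda>C. ddot22 (h C) (h C))"
    unfolding cov0_def
    by (rule eqI) (simp add: harm coords cmod_power2, simp add: power2_eq_square)
  have 3: "pullback (\<lambda>q. 8 * sq_w q) = cov0 (\<lambda>C. qdot44 (H C) (H C))"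
    unfolding cov0_def
    by (rule eqI) (simp add: harm coords cmod_power2, simp add: power2_eq_square)
  have 4: "pullback (\<lambda>q. 4 * Re (rel_wu q)) = cov0 (\<lambda>C. ddot22 (h C) (ddot42 (H C) (h C)))"
    unfolding cov0_def
    by (rule eqI) (simp add: harm coords power2_eq_square algebra_simps)
  have 5: "pullback sq_x = cov2 (\<lambda>C. id_tensor)"
    unfolding cov2_def by (rule eqI) (simp add: harm coords)
  have 6: "pullback (\<lambda>q. Re (rel_ux q)) = cov2 h"
    unfolding cov2_def by (rule eqI) (simp only: harm coords)
  have 7: "pullback (\<lambda>q. 2 * Re (rel_wux q)) = cov2 (\<lambda>C. ddot42 (H C) (h C))"
    unfolding cov2_def by (rule eqI) (simp only: harm coords, simp add: algebra_simps)
  have 8: "pullback (\<lambda>q. Re (rel_wx q)) = cov4 H"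
    unfolding cov4_def by (rule eqI) (simp only: harm coords)
  have 9: "pullback (\<lambda>q. 4 * Im (rel_wu q)) = cov0 (\<lambda>C. ddot22 (h C) (ddot42 (H C) (cross22 id_tensor (h C))))"
    unfolding cov0_def by (rule eqI) (simp add: harm coords power2_eq_square algebra_simps)
  have 10: "pullback (\<lambda>q. - Im (rel_ux q)) = cov2 (\<lambda>C. cross22 id_tensor (h C))"
    unfolding cov2_def by (rule eqI) (simp only: harm coords, simp only: Re_Im mult.assoc)
  have 11: "pullback (\<lambda>q. 2 * Im (rel_wux q)) = cov2 (\<lambda>C. ddot42 (H C) (cross22 id_tensor (h C)))"
    unfolding cov2_def by (rule eqI) (simp only: harm coords, simp add: algebra_simps)
  have 12: "pullback (\<lambda>q. - Im (rel_wx q)) = cov4 (\<lambda>C. cross24 id_tensor (H C))"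
    unfolding cov4_def by (rule eqI) (simp only: harm coords, simp only: Re_Im mult.assoc)
  show ?thesis unfolding gens_def list.map 1 2 3 4 5 6 7 8 9 10 11 12 ..
qed

end

theorem corollary8p9:
  fixes lam mu :: "tensor4 \<Rightarrow> real" and h :: "tensor4 \<Rightarrow> tensor2" and H :: "tensor4 \<Rightarrow> tensor4"
  assumes "harmonic_decomposition (\<lambda>C. (lam C, mu C, h C, H C))"
  shows
    "(let B = {cov0 lam, cov0 mu,
               cov0 (\<lambda>C. ddot22 (h C) (h C)),
               cov0 (\<lambda>C. qdot44 (H C) (H C)),
               cov0 (\<lambda>C. ddot22 (h C) (ddot42 (H C) (h C))),
               cov2 (\<lambda>C. id_tensor),
               cov2 h,
               cov2 (\<lambda>C. ddot42 (H C) (h C)),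
               cov4 H,
               cov0 (\<lambda>C. ddot22 (h C) (ddot42 (H C) (cross22 id_tensor (h C)))),
               cov2 (\<lambda>C. cross22 id_tensor (h C)),
               cov2 (\<lambda>C. ddot42 (H C) (cross22 id_tensor (h C))),
               cov4 (\<lambda>C. cross24 id_tensor (H C))}
      in minimal_integrity_basis (Ela \<times> UNIV) (Cov Ela act4 SO2) B \<and>
         card B = 13 \<and> card {c \<in> B. has_order Ela 0 c} = 6)
     \<and>
     (let B = {cov0 lam, cov0 mu,
               cov0 (\<lambda>C. ddot22 (h C) (h C)),
               cov0 (\<lambda>C. qdot44 (H C) (H C)),
               cov0 (\<lambda>C. ddot22 (h C) (ddot42 (H C) (h C))),
               cov2 (\<lambda>C. id_tensor),
               cov2 h,
               cov2 (\<lambda>C. ddot42 (H C) (h C)),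
               cov4 H}
      in minimal_integrity_basis (Ela \<times> UNIV) (Cov Ela act4 O2) B \<and>
         card B = 9 \<and> card {c \<in> B. has_order Ela 0 c} = 5)"
proof -
  interpret ela_decomposition lam mu h H by unfold_locales (rule assms)
  have all: "take 13 gens = gens" by (simp add: length_gens)
  have "distinct (map pullback gens)"
    using minimal_prefix(2)[of _ 13] basis_SO2 by (simp add: all length_gens)
  then have card_13: "card (set (map pullback gens)) = 13"
    "card {c \<in> set (map pullback gens). has_order Ela 0 c} = 6"
    by (simp_all only: distinct_card card_order_0 orders_of_gens) (simp_all add: length_gens)
  have distinct_9: "distinct (map pullback (take 9 gens))"
    using minimal_prefix(2)[OF basis_O2] by (simp add: length_gens)
  have "map (\<lambda>f. has_order Ela 0 (pullback f)) (take 9 gens) =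
    [True, True, True, True, True, False, False, False, False]"
    by (simp only: take_map[symmetric] orders_of_gens) simp
  then have card_9: "card (set (map pullback (take 9 gens))) = 9"
    "card {c \<in> set (map pullback (take 9 gens)). has_order Ela 0 c} = 5"
    using distinct_9 by (simp_all only: distinct_card card_order_0) (simp_all add: length_gens)
  have "minimal_integrity_basis V (Cov Ela act4 SO2) (set (map pullback gens))"
    using minimal_prefix(1)[of _ 13] basis_SO2 by (simp add: all length_gens)
  note SO2 = this card_13
  have "minimal_integrity_basis V (Cov Ela act4 O2) (set (map pullback (take 9 gens)))"
    by (rule minimal_prefix(1)[OF basis_O2]) (simp add: length_gens)
  note O2 = this card_9
  have take_9: "take 9 (a # b # c # d # e # f # g # i # j # xs) = [a, b, c, d, e, f, g, i, j]"
    for a b c d e f g i j :: "tensor4 \<times> vec2 \<Rightarrow> real" and xs by simp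
  show ?thesis
    unfolding Let_def
    using SO2[unfolded pullback_gens list.set]
      O2[unfolded take_map[symmetric] pullback_gens take_9 list.set]
    by (intro conjI)
qed

end
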